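(* Let $(G,C)$ be a C-group. There exists a valuation $v:G\to\Gamma\cup\{\infty\}$ with value set $\Gamma\cup\{\infty\}$ such that the following holds: 1. For any $\gamma\in\Gamma$, $C$ induces a (compatible) C-relation $C_{\gamma}$ on the quotient $G^{\gamma}/G_{\gamma}$ defined, for $f,g,h\in G^\gamma$, by the formula $$C_{\gamma}(fG_{\gamma},gG_{\gamma},hG_{\gamma})\Leftrightarrow fh^{-1}\notin G_{\gamma}\wedge\big(gh^{-1}\in G_{\gamma}\vee C(f,g,h)\big).$$ 2. For each $\gamma\in\Gamma$, $C_{\gamma}$ is of elementary type. 3. If $\gamma<\delta$ are elements of $\Gamma$ such that $C_{\gamma}$ and $C_{\delta}$ are both valuational, then there exists $\alpha\in\Gamma$ between $\gamma$ and $\delta$ such that $C_{\alpha}$ is order-type.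
   Context: A C-relation on a set is a ternary relation $C$ such that for all $x,y,z,w$: $C(x,y,z)\Rightarrow C(x,z,y)$; $C(x,y,z)\Rightarrow\neg C(y,x,z)$; $C(x,y,z)\Rightarrow C(w,y,z)\vee C(x,w,z)$; $x\neq y\Rightarrow C(x,y,y)$. A C-relation on a group is compatible if $C(x,y,z)$ implies $C(vxu,vyu,vzu)$ for all $x,y,z,u,v$. A C-group is a group with a compatible C-relation. With $g^z:=zgz^{-1}$, a valuation on a group $G$ is a map $v:G\to\Gamma\cup\{\infty\}$, where $\Gamma$ is totally ordered and $\gamma<\infty$ for all $\gamma\in\Gamma$, such that for all $g,h,z$: $v(g)=\infty\Leftrightarrow g=1$; $v(gh^{-1})\geq\min(v(g),v(h))$; $v(g)\leq v(h)\Leftrightarrow v(g^z)\leq v(h^z)$. Put $G^{\gamma}=\{g\in G\mid v(g)\geq\gamma\}$ and $G_{\gamma}=\{g\in G\mid v(g)>\gamma\}$; these are subgroups of $G$ and $G_\gamma$ is normal in $G^\gamma$. A compatible C-relation on a group is order-type if it is of the form $C(x,y,z)\Leftrightarrow(y<x\wedge z<x)\vee(y=z\neq x)$ for a total order $\leq$ making the group a (bi-)ordered group, i.e. $x\leq y$ implies $xz\leq yz$ and $zx\leq zy$. It is valuational if it is of the form $C(x,y,z)\Leftrightarrow v(yz^{-1})>v(xz^{-1})$ for a valuation $v$ on the group. It is of elementary type if it is order-type or valuational. *)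

theory Defs
  imports "HOL-Algebra.Coset"
begin

definition C_relation_on :: "'a set \<Rightarrow> ('a \<Rightarrow> 'a \<Rightarrow> 'a \<Rightarrow> bool) \<Rightarrow> bool" where
  "C_relation_on A C \<longleftrightarrow>
     (\<forall>x\<in>A. \<forall>y\<in>A. \<forall>z\<in>A. C x y z \<longrightarrow> C x z y) \<and>
     (\<forall>x\<in>A. \<forall>y\<in>A. \<forall>z\<in>A. C x y z \<longrightarrow> \<not> C y x z) \<and>
     (\<forall>x\<in>A. \<forall>y\<in>A. \<forall>z\<in>A. \<forall>w\<in>A. C x y z \<longrightarrow> C w y z \<or> C x w z) \<and>
     (\<forall>x\<in>A. \<forall>y\<in>A. x \<noteq> y \<longrightarrow> C x y y)"

definition C_compatible :: "('a, 'b) monoid_scheme \<Rightarrow> ('a \<Rightarrow> 'a \<Rightarrow> 'a \<Rightarrow> bool) \<Rightarrow> bool" where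
  "C_compatible G C \<longleftrightarrow>
     (\<forall>x\<in>carrier G. \<forall>y\<in>carrier G. \<forall>z\<in>carrier G. \<forall>u\<in>carrier G. \<forall>v\<in>carrier G.
        C x y z \<longrightarrow>
        C (v \<otimes>\<^bsub>G\<^esub> x \<otimes>\<^bsub>G\<^esub> u) (v \<otimes>\<^bsub>G\<^esub> y \<otimes>\<^bsub>G\<^esub> u) (v \<otimes>\<^bsub>G\<^esub> z \<otimes>\<^bsub>G\<^esub> u))"

definition C_group :: "('a, 'b) monoid_scheme \<Rightarrow> ('a \<Rightarrow> 'a \<Rightarrow> 'a \<Rightarrow> bool) \<Rightarrow> bool" where
  "C_group G C \<longleftrightarrow> group G \<and> C_relation_on (carrier G) C \<and> C_compatible G C"

text \<open>A totally ordered set \<open>\<Gamma>\<close> is given by a carrier \<open>\<Gamma>\<close> and a reflexive relation \<open>r\<close> on it,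
  rather than by a type of class \<open>linorder\<close>, because valuations are quantified existentially
  together with their value sets. In \<open>\<Gamma> \<union> {\<infinity>}\<close>, \<open>None\<close> stands for \<open>\<infinity>\<close>.\<close>

definition val_le :: "'g rel \<Rightarrow> 'g option \<Rightarrow> 'g option \<Rightarrow> bool" where
  "val_le r a b \<longleftrightarrow> b = None \<or> (\<exists>\<alpha> \<beta>. a = Some \<alpha> \<and> b = Some \<beta> \<and> (\<alpha>, \<beta>) \<in> r)"

definition val_less :: "'g rel \<Rightarrow> 'g option \<Rightarrow> 'g option \<Rightarrow> bool" where
  "val_less r a b \<longleftrightarrow> val_le r a b \<and> a \<noteq> b"

definition val_min :: "'g rel \<Rightarrow> 'g option \<Rightarrow> 'g option \<Rightarrow> 'g option" where
  "val_min r a b = (if val_le r a b then a else b)"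

definition valuation ::
  "('a, 'b) monoid_scheme \<Rightarrow> 'g set \<Rightarrow> 'g rel \<Rightarrow> ('a \<Rightarrow> 'g option) \<Rightarrow> bool" where
  "valuation G \<Gamma> r v \<longleftrightarrow>
     linear_order_on \<Gamma> r \<and>
     v \<in> carrier G \<rightarrow> insert None (Some ` \<Gamma>) \<and>
     (\<forall>g\<in>carrier G. v g = None \<longleftrightarrow> g = \<one>\<^bsub>G\<^esub>) \<and>
     (\<forall>g\<in>carrier G. \<forall>h\<in>carrier G. val_le r (val_min r (v g) (v h)) (v (g \<otimes>\<^bsub>G\<^esub> inv\<^bsub>G\<^esub> h))) \<and>
     (\<forall>g\<in>carrier G. \<forall>h\<in>carrier G. \<forall>z\<in>carrier G.
        val_le r (v g) (v h) \<longleftrightarrow>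
        val_le r (v (z \<otimes>\<^bsub>G\<^esub> g \<otimes>\<^bsub>G\<^esub> inv\<^bsub>G\<^esub> z)) (v (z \<otimes>\<^bsub>G\<^esub> h \<otimes>\<^bsub>G\<^esub> inv\<^bsub>G\<^esub> z)))"

text \<open>The subgroups \<open>G\<^sup>\<gamma>\<close> and \<open>G\<^sub>\<gamma>\<close>, and the quotient \<open>G\<^sup>\<gamma>/G\<^sub>\<gamma>\<close>.\<close>

definition val_ge_set ::
  "('a, 'b) monoid_scheme \<Rightarrow> 'g rel \<Rightarrow> ('a \<Rightarrow> 'g option) \<Rightarrow> 'g \<Rightarrow> 'a set" where
  "val_ge_set G r v \<gamma> = {g \<in> carrier G. val_le r (Some \<gamma>) (v g)}"

definition val_gt_set ::
  "('a, 'b) monoid_scheme \<Rightarrow> 'g rel \<Rightarrow> ('a \<Rightarrow> 'g option) \<Rightarrow> 'g \<Rightarrow> 'a set" where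
  "val_gt_set G r v \<gamma> = {g \<in> carrier G. val_less r (Some \<gamma>) (v g)}"

definition val_quotient ::
  "('a, 'b) monoid_scheme \<Rightarrow> 'g rel \<Rightarrow> ('a \<Rightarrow> 'g option) \<Rightarrow> 'g \<Rightarrow> 'a set monoid" where
  "val_quotient G r v \<gamma> = (G\<lparr>carrier := val_ge_set G r v \<gamma>\<rparr>) Mod (val_gt_set G r v \<gamma>)"

definition bi_order_on :: "('a, 'b) monoid_scheme \<Rightarrow> 'a rel \<Rightarrow> bool" where
  "bi_order_on G r \<longleftrightarrow>
     linear_order_on (carrier G) r \<and>
     (\<forall>x\<in>carrier G. \<forall>y\<in>carrier G. \<forall>z\<in>carrier G.
        (x, y) \<in> r \<longrightarrow> (x \<otimes>\<^bsub>G\<^esub> z, y \<otimes>\<^bsub>G\<^esub> z) \<in> r \<and> (z \<otimes>\<^bsub>G\<^esub> x, z \<otimes>\<^bsub>G\<^esub> y) \<in> r)"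

definition order_type :: "('a, 'b) monoid_scheme \<Rightarrow> ('a \<Rightarrow> 'a \<Rightarrow> 'a \<Rightarrow> bool) \<Rightarrow> bool" where
  "order_type G C \<longleftrightarrow>
     (\<exists>r. bi_order_on G r \<and>
        (\<forall>x\<in>carrier G. \<forall>y\<in>carrier G. \<forall>z\<in>carrier G.
           C x y z \<longleftrightarrow>
             ((y, x) \<in> r \<and> y \<noteq> x \<and> (z, x) \<in> r \<and> z \<noteq> x) \<or> (y = z \<and> z \<noteq> x)))"

definition valuation_C ::
  "('a, 'b) monoid_scheme \<Rightarrow> 'g rel \<Rightarrow> ('a \<Rightarrow> 'g option) \<Rightarrow> ('a \<Rightarrow> 'a \<Rightarrow> 'a \<Rightarrow> bool) \<Rightarrow> bool" where
  "valuation_C G r v C \<longleftrightarrow>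
     (\<forall>x\<in>carrier G. \<forall>y\<in>carrier G. \<forall>z\<in>carrier G.
        C x y z \<longleftrightarrow> val_less r (v (x \<otimes>\<^bsub>G\<^esub> inv\<^bsub>G\<^esub> z)) (v (y \<otimes>\<^bsub>G\<^esub> inv\<^bsub>G\<^esub> z)))"

text \<open>HOL cannot quantify existentially over the type of the values. Values in \<open>'a set\<close> suffice:
  each attained value can be replaced by the fibre of the valuation over it; see
  \<open>valuation_fibres\<close> and \<open>valuationalI\<close> below.\<close>

definition valuational :: "('a, 'b) monoid_scheme \<Rightarrow> ('a \<Rightarrow> 'a \<Rightarrow> 'a \<Rightarrow> bool) \<Rightarrow> bool" where
  "valuational G C \<longleftrightarrow>
     (\<exists>(\<Gamma> :: 'a set set) r v. valuation G \<Gamma> r v \<and> valuation_C G r v C)"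

definition elementary_type :: "('a, 'b) monoid_scheme \<Rightarrow> ('a \<Rightarrow> 'a \<Rightarrow> 'a \<Rightarrow> bool) \<Rightarrow> bool" where
  "elementary_type G C \<longleftrightarrow> order_type G C \<or> valuational G C"

lemma valuation_fibres:
  fixes G :: "('a, 'b) monoid_scheme" (structure) and \<Gamma> :: "'g set"
  assumes "group G" and val: "valuation G \<Gamma> r v"
  shows "\<exists>(\<Gamma>' :: 'a set set) r' v'. valuation G \<Gamma>' r' v' \<and>
           v' ` carrier G = insert None (Some ` \<Gamma>') \<and>
           (\<forall>g\<in>carrier G. \<forall>h\<in>carrier G. val_le r' (v' g) (v' h) \<longleftrightarrow> val_le r (v g) (v h)) \<and>
           (\<forall>g\<in>carrier G. \<forall>h\<in>carrier G. val_less r' (v' g) (v' h) \<longleftrightarrow> val_less r (v g) (v h))"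
proof -
  interpret group G by fact
  define F where "F \<gamma> = {g \<in> carrier G. v g = Some \<gamma>}" for \<gamma>
  define \<Gamma>0 where "\<Gamma>0 = {\<gamma> \<in> \<Gamma>. Some \<gamma> \<in> v ` carrier G}"
  define \<Gamma>' where "\<Gamma>' = F ` \<Gamma>0"
  define r' where "r' = {(F a, F b) | a b. a \<in> \<Gamma>0 \<and> b \<in> \<Gamma>0 \<and> (a, b) \<in> r}"
  define v' where "v' g = map_option F (v g)" for g
  have lin: "linear_order_on \<Gamma> r" and v: "v \<in> carrier G \<rightarrow> insert None (Some ` \<Gamma>)"
    using val by (auto simp: valuation_def)
  have inj: "a = b" if "a \<in> \<Gamma>0" "b \<in> \<Gamma>0" "F a = F b" for a b
  proof -
    from that(1) obtain g where "g \<in> carrier G" "v g = Some a" by (auto simp: \<Gamma>0_def)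
    then have "g \<in> F a" by (simp add: F_def)
    then have "g \<in> F b" using that(3) by simp
    with \<open>v g = Some a\<close> show ?thesis by (simp add: F_def)
  qed
  have \<Gamma>0: "a \<in> \<Gamma>0" if "g \<in> carrier G" "v g = Some a" for g a
    using that v unfolding \<Gamma>0_def by force
  have r'_iff: "(F a, F b) \<in> r' \<longleftrightarrow> (a, b) \<in> r" if "a \<in> \<Gamma>0" "b \<in> \<Gamma>0" for a b
    using that inj unfolding r'_def by blast
  have le: "val_le r' (v' g) (v' h) \<longleftrightarrow> val_le r (v g) (v h)"
    if "g \<in> carrier G" "h \<in> carrier G" for g h
    using that \<Gamma>0[of g] \<Gamma>0[of h] r'_iff
    by (cases "v g"; cases "v h") (simp_all add: val_le_def v'_def)
  have F_eq: "F a = F b \<longleftrightarrow> a = b" if "a \<in> \<Gamma>0" "b \<in> \<Gamma>0" for a b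
    using inj[OF that] by blast
  have eq: "v' g = v' h \<longleftrightarrow> v g = v h" if "g \<in> carrier G" "h \<in> carrier G" for g h
    using that \<Gamma>0[of g] \<Gamma>0[of h] F_eq
    by (cases "v g"; cases "v h") (simp_all add: v'_def)
  have less: "val_less r' (v' g) (v' h) \<longleftrightarrow> val_less r (v g) (v h)"
    if "g \<in> carrier G" "h \<in> carrier G" for g h
    using that le eq by (simp add: val_less_def)
  have rr: "refl_on \<Gamma> r" "trans r" "antisym r" "total_on \<Gamma> r"
    using lin by (auto simp: order_on_defs)
  have sub: "\<Gamma>0 \<subseteq> \<Gamma>" by (auto simp: \<Gamma>0_def)
  have lin': "linear_order_on \<Gamma>' r'"
    unfolding order_on_defs
  proof (intro conjI)
    show "r' \<subseteq> \<Gamma>' \<times> \<Gamma>'" by (auto simp: r'_def \<Gamma>'_def)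
    show "refl_on \<Gamma>' r'"
      using rr(1) sub r'_iff by (auto simp: refl_on_def \<Gamma>'_def)
    show "trans r'"
    proof (rule transI)
      fix x y z assume "(x, y) \<in> r'" "(y, z) \<in> r'"
      then obtain a b c d where *: "x = F a" "y = F b" "y = F c" "z = F d"
        "a \<in> \<Gamma>0" "b \<in> \<Gamma>0" "c \<in> \<Gamma>0" "d \<in> \<Gamma>0" "(a, b) \<in> r" "(c, d) \<in> r"
        unfolding r'_def by blast
      have "F b = F c" using *(2,3) by simp
      then have "b = c" by (rule inj[OF *(6,7)])
      then have "(a, d) \<in> r" using *(9,10) by (metis transD[OF rr(2)])
      then show "(x, z) \<in> r'" using *(1,4) r'_iff[OF *(5,8)] by simp
    qed
    show "antisym r'"
    proof (rule antisymI)
      fix x y assume "(x, y) \<in> r'" "(y, x) \<in> r'"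
      then obtain a b where *: "x = F a" "y = F b" "a \<in> \<Gamma>0" "b \<in> \<Gamma>0" "(a, b) \<in> r"
        and "(F b, F a) \<in> r'"
        unfolding r'_def by blast
      then have "(b, a) \<in> r" using r'_iff[OF *(4,3)] by simp
      then have "a = b" using *(5) rr(3) by (metis antisymD)
      then show "x = y" using *(1,2) by simp
    qed
    show "total_on \<Gamma>' r'"
      unfolding total_on_def
    proof (intro ballI impI)
      fix x y assume "x \<in> \<Gamma>'" "y \<in> \<Gamma>'" "x \<noteq> y"
      then obtain a b where *: "x = F a" "y = F b" "a \<in> \<Gamma>0" "b \<in> \<Gamma>0" "a \<noteq> b"
        unfolding \<Gamma>'_def by blast
      then have "(a, b) \<in> r \<or> (b, a) \<in> r" using rr(4) sub by (auto simp: total_on_def)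
      then show "(x, y) \<in> r' \<or> (y, x) \<in> r'" using *(1,2) r'_iff[OF *(3,4)] r'_iff[OF *(4,3)] by simp
    qed
  qed
  have img: "v' ` carrier G = insert None (Some ` \<Gamma>')"
  proof
    show "v' ` carrier G \<subseteq> insert None (Some ` \<Gamma>')"
    proof
      fix x assume "x \<in> v' ` carrier G"
      then obtain g where g: "g \<in> carrier G" "x = v' g" by blast
      then show "x \<in> insert None (Some ` \<Gamma>')"
        using \<Gamma>0[of g] by (cases "v g") (auto simp: v'_def \<Gamma>'_def)
    qed
    have "v' \<one> = None" using val by (simp add: v'_def valuation_def)
    then have "None \<in> v' ` carrier G" by (intro image_eqI[of _ _ \<one>]) auto
    moreover have "Some (F a) \<in> v' ` carrier G" if "a \<in> \<Gamma>0" for a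
    proof -
      from that obtain g where "g \<in> carrier G" "v g = Some a" by (auto simp: \<Gamma>0_def)
      then have "v' g = Some (F a)" by (simp add: v'_def)
      with \<open>g \<in> carrier G\<close> show ?thesis by (rule_tac image_eqI[OF sym])
    qed
    ultimately show "insert None (Some ` \<Gamma>') \<subseteq> v' ` carrier G"
      unfolding \<Gamma>'_def by blast
  qed
  have "valuation G \<Gamma>' r' v'"
    unfolding valuation_def
  proof (intro conjI ballI)
    show "v' \<in> carrier G \<rightarrow> insert None (Some ` \<Gamma>')" using img by blast
    show "v' g = None \<longleftrightarrow> g = \<one>" if "g \<in> carrier G" for g
      using that val by (simp add: v'_def valuation_def)
    show "val_le r' (val_min r' (v' g) (v' h)) (v' (g \<otimes> inv h))"
      if "g \<in> carrier G" "h \<in> carrier G" for g h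
    proof -
      have "val_le r (val_min r (v g) (v h)) (v (g \<otimes> inv h))"
        using that val by (simp add: valuation_def)
      then show ?thesis using that by (auto simp: val_min_def le split: if_splits)
    qed
    show "val_le r' (v' g) (v' h) \<longleftrightarrow>
          val_le r' (v' (z \<otimes> g \<otimes> inv z)) (v' (z \<otimes> h \<otimes> inv z))"
      if "g \<in> carrier G" "h \<in> carrier G" "z \<in> carrier G" for g h z
    proof -
      have "val_le r (v g) (v h) \<longleftrightarrow>
            val_le r (v (z \<otimes> g \<otimes> inv z)) (v (z \<otimes> h \<otimes> inv z))"
        using that val unfolding valuation_def by blast
      then show ?thesis using that by (simp add: le)
    qed
  qed (rule lin')
  with img le less show ?thesis
    by (intro exI[of _ \<Gamma>'] exI[of _ r'] exI[of _ v']) simp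
qed

lemma valuationalI:
  fixes \<Gamma> :: "'g set"
  assumes "group G" "valuation G \<Gamma> r v" "valuation_C G r v C"
  shows "valuational G C"
proof -
  interpret group G by fact
  obtain \<Gamma>' :: "'a set set" and r' v' where *: "valuation G \<Gamma>' r' v'"
    "\<forall>g\<in>carrier G. \<forall>h\<in>carrier G. val_less r' (v' g) (v' h) \<longleftrightarrow> val_less r (v g) (v h)"
    using valuation_fibres[OF assms(1,2)] by blast
  then have "valuation_C G r' v' C"
    using assms(3) by (auto simp: valuation_C_def)
  with * show ?thesis unfolding valuational_def by blast
qed

end

theory Submission
  imports Defs
begin

text \<open>
  Since \<open>C\<close> is translation invariant, it is determined by \<open>x \<prec> y \<longleftrightarrow> C y x \<one>\<close>, a conjugation-invariant
  strict weak order with least element \<open>\<one>\<close> such that \<open>x \<prec> y\<close> iff \<open>inv x \<prec> y \<otimes> inv x\<close>.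
  Call \<open>x\<close> balanced if neither of \<open>x\<close> and \<open>inv x\<close> precedes the other. Comparing elements by the
  smaller of \<open>x\<close> and \<open>inv x\<close>, with ties between a balanced and an unbalanced element broken in
  favour of the balanced one, gives an ultrametric order, that is, a valuation. Its quotients are
  order-type for unbalanced values (the positive elements being those with \<open>inv x \<prec> x\<close>) and
  valuational for balanced values. Merging balanced values that have no unbalanced value between
  them keeps the quotients valuational and yields the alternation.
\<close>

section \<open>Valuations from conjugation-invariant strict weak orders\<close>

lemma (in group) mult_inv_cancel:
  assumes "x \<in> carrier G" "y \<in> carrier G"
  shows "inv x \<otimes> (x \<otimes> y) = y" "x \<otimes> (inv x \<otimes> y) = y"
  using assms by (simp_all add: m_assoc[symmetric])

text \<open>By \<open>asym\<close> and \<open>cotrans\<close>, incomparability under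
  \<open>R\<close> is an equivalence relation. Its classes become the values, in reverse order, so
  that \<open>\<one>\<close> gets the value infinity. The hypothesis \<open>mult\<close> is the
  ultrametric inequality. The lemma serves twice: for the valuation of the theorem and for the
  valuational quotients.\<close>

lemma (in group) valuation_from_strict_weak_order:
  fixes R :: "'a \<Rightarrow> 'a \<Rightarrow> bool"
  assumes asym: "\<And>x y. R x y \<Longrightarrow> x \<in> carrier G \<Longrightarrow> y \<in> carrier G \<Longrightarrow> \<not> R y x"
    and cotrans: "\<And>x y w. R x y \<Longrightarrow> x \<in> carrier G \<Longrightarrow> y \<in> carrier G \<Longrightarrow> w \<in> carrier G \<Longrightarrow> R x w \<or> R w y"
    and one: "\<And>x. x \<in> carrier G \<Longrightarrow> x \<noteq> \<one> \<Longrightarrow> R \<one> x"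
    and mult: "\<And>x y z. R z (x \<otimes> inv y) \<Longrightarrow> x \<in> carrier G \<Longrightarrow> y \<in> carrier G \<Longrightarrow> z \<in> carrier G \<Longrightarrow> R z x \<or> R z y"
    and conj: "\<And>x y z. R x y \<Longrightarrow> x \<in> carrier G \<Longrightarrow> y \<in> carrier G \<Longrightarrow> z \<in> carrier G \<Longrightarrow>
      R (z \<otimes> x \<otimes> inv z) (z \<otimes> y \<otimes> inv z)"
  shows "\<exists>(\<Gamma> :: 'a set set) r v. valuation G \<Gamma> r v \<and> v ` carrier G = insert None (Some ` \<Gamma>) \<and>
    (\<forall>x\<in>carrier G. \<forall>y\<in>carrier G. val_le r (v x) (v y) \<longleftrightarrow> \<not> R x y) \<and>
    (\<forall>x\<in>carrier G. \<forall>y\<in>carrier G. val_less r (v x) (v y) \<longleftrightarrow> R y x)"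
proof -
  \<comment> \<open>the value of \<open>x \<noteq> \<one>\<close> is encoded as the set of elements of at least that value\<close>
  define B where "B x = {g \<in> carrier G. \<not> R x g}" for x
  define \<Gamma> where "\<Gamma> = B ` (carrier G - {\<one>})"
  define r where "r = {(M, N). M \<in> \<Gamma> \<and> N \<in> \<Gamma> \<and> N \<subseteq> M}"
  define v where "v x = (if x = \<one> then None else Some (B x))" for x
  have irrefl: "\<not> R x x" if "x \<in> carrier G" for x
    using asym that by blast
  have sub: "B y \<subseteq> B x \<longleftrightarrow> \<not> R x y" if "x \<in> carrier G" "y \<in> carrier G" for x y
    unfolding B_def using irrefl cotrans that by blast
  have le: "val_le r (v x) (v y) \<longleftrightarrow> \<not> R x y" if "x \<in> carrier G" "y \<in> carrier G" for x y
  proof -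
    have "\<not> R x \<one>" using asym[of x \<one>] one[of x] irrefl[of \<one>] that by (cases "x = \<one>") auto
    moreover have "R \<one> y" if "y \<noteq> \<one>" using one that \<open>y \<in> carrier G\<close> by blast
    moreover have "x \<noteq> \<one> \<Longrightarrow> B x \<in> \<Gamma>" "y \<noteq> \<one> \<Longrightarrow> B y \<in> \<Gamma>" using that by (auto simp: \<Gamma>_def)
    ultimately show ?thesis
      using sub[OF that] by (auto simp: val_le_def v_def r_def)
  qed
  have eq: "v x = v y" if "x \<in> carrier G" "y \<in> carrier G" "\<not> R x y" "\<not> R y x" for x y
    using sub[of x y] sub[of y x] one that by (auto simp: v_def)
  have less: "val_less r (v x) (v y) \<longleftrightarrow> R y x" if "x \<in> carrier G" "y \<in> carrier G" for x y
    using le[of x y] le[of y y] le[of y x] le[of x x] eq[of x y] asym[of y x] irrefl that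
    unfolding val_less_def by metis
  have img: "v ` carrier G = insert None (Some ` \<Gamma>)"
    unfolding v_def \<Gamma>_def by auto
  have "linear_order_on \<Gamma> r"
    unfolding order_on_defs
  proof (intro conjI)
    show "total_on \<Gamma> r"
      unfolding total_on_def r_def \<Gamma>_def using sub asym by auto
  qed (auto simp: r_def refl_on_def trans_def antisym_def)
  \<comment> \<open>Take \<open>z\<close> in \<open>mult\<close> to be the one of \<open>g\<close>
    and \<open>h\<close> that realises the minimum: both alternatives of the conclusion are then
    excluded.\<close>
  moreover have "val_le r (val_min r (v g) (v h)) (v (g \<otimes> inv h))"
    if "g \<in> carrier G" "h \<in> carrier G" for g h
    using le[of g h] le[of g "g \<otimes> inv h"] le[of h "g \<otimes> inv h"] mult[of g g h] mult[of h g h]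
      asym[of g h] irrefl that
    by (auto simp: val_min_def)
  moreover have "val_le r (v g) (v h) \<longleftrightarrow> val_le r (v (z \<otimes> g \<otimes> inv z)) (v (z \<otimes> h \<otimes> inv z))"
    if "g \<in> carrier G" "h \<in> carrier G" "z \<in> carrier G" for g h z
    using conj[of g h z] conj[of "z \<otimes> g \<otimes> inv z" "z \<otimes> h \<otimes> inv z" "inv z"] that
    by (auto simp: le m_assoc mult_inv_cancel)
  moreover have "v \<in> carrier G \<rightarrow> insert None (Some ` \<Gamma>)" using img by blast
  moreover have "v g = None \<longleftrightarrow> g = \<one>" for g by (simp add: v_def)
  ultimately have "valuation G \<Gamma> r v"
    unfolding valuation_def by simp
  with img le less show ?thesis
    by (intro exI[of _ \<Gamma>] exI[of _ r] exI[of _ v]) simp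
qed

section \<open>The strict weak order of a C-group\<close>

locale c_group = group G for G :: "('a, 'b) monoid_scheme" (structure) +
  fixes C :: "'a \<Rightarrow> 'a \<Rightarrow> 'a \<Rightarrow> bool"
  assumes C_group: "C_group G C"
begin

definition prec :: "'a \<Rightarrow> 'a \<Rightarrow> bool"  (infix "\<prec>" 50) where
  "x \<prec> y \<longleftrightarrow> C y x \<one>"

abbreviation preceq :: "'a \<Rightarrow> 'a \<Rightarrow> bool"  (infix "\<preceq>" 50) where
  "x \<preceq> y \<equiv> \<not> y \<prec> x"

lemma C_swap:
  assumes "x \<in> carrier G" "y \<in> carrier G" "z \<in> carrier G"
  shows "C x y z \<longleftrightarrow> C x z y"
  using C_group assms unfolding C_group_def C_relation_on_def by blast

lemma C_mult_right:
  assumes "x \<in> carrier G" "y \<in> carrier G" "z \<in> carrier G" "u \<in> carrier G"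
  shows "C (x \<otimes> u) (y \<otimes> u) (z \<otimes> u) \<longleftrightarrow> C x y z"
proof -
  have *: "C (x \<otimes> u) (y \<otimes> u) (z \<otimes> u)"
    if "C x y z" "x \<in> carrier G" "y \<in> carrier G" "z \<in> carrier G" "u \<in> carrier G" for x y z u
  proof -
    have "C (\<one> \<otimes> x \<otimes> u) (\<one> \<otimes> y \<otimes> u) (\<one> \<otimes> z \<otimes> u)"
      using C_group that unfolding C_group_def C_compatible_def by blast
    then show ?thesis using that by simp
  qed
  show ?thesis
    using *[of x y z u] *[of "x \<otimes> u" "y \<otimes> u" "z \<otimes> u" "inv u"] assms by (auto simp: m_assoc)
qed

lemma C_mult_left:
  assumes "x \<in> carrier G" "y \<in> carrier G" "z \<in> carrier G" "u \<in> carrier G"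
  shows "C (u \<otimes> x) (u \<otimes> y) (u \<otimes> z) \<longleftrightarrow> C x y z"
proof -
  have *: "C (u \<otimes> x) (u \<otimes> y) (u \<otimes> z)"
    if "C x y z" "x \<in> carrier G" "y \<in> carrier G" "z \<in> carrier G" "u \<in> carrier G" for x y z u
  proof -
    have "C (u \<otimes> x \<otimes> \<one>) (u \<otimes> y \<otimes> \<one>) (u \<otimes> z \<otimes> \<one>)"
      using C_group that unfolding C_group_def C_compatible_def by blast
    then show ?thesis using that by simp
  qed
  show ?thesis
    using *[of x y z u] *[of "u \<otimes> x" "u \<otimes> y" "u \<otimes> z" "inv u"] assms
    by (auto simp: m_assoc[symmetric])
qed

lemma C_iff_prec:
  assumes "f \<in> carrier G" "g \<in> carrier G" "h \<in> carrier G"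
  shows "C f g h \<longleftrightarrow> g \<otimes> inv h \<prec> f \<otimes> inv h"
  using C_mult_right[of f g h "inv h"] assms by (simp add: prec_def)

text \<open>Right translation by \<open>inv x\<close> turns \<open>C y \<one> x\<close> into the
  left side, and \<open>C_swap\<close> exchanges \<open>\<one>\<close> and \<open>x\<close>. This is
  the symmetry axiom of \<open>C\<close> in terms of \<open>\<prec>\<close>.\<close>

lemma prec_inv_right:
  assumes "x \<in> carrier G" "y \<in> carrier G"
  shows "inv x \<prec> y \<otimes> inv x \<longleftrightarrow> x \<prec> y"
  using assms C_iff_prec[of y \<one> x] by (simp add: prec_def C_swap)

lemma prec_conj:
  assumes "x \<in> carrier G" "y \<in> carrier G" "z \<in> carrier G"
  shows "z \<otimes> x \<otimes> inv z \<prec> z \<otimes> y \<otimes> inv z \<longleftrightarrow> x \<prec> y"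
  using assms C_mult_left[of y x \<one> z] C_mult_right[of "z \<otimes> y" "z \<otimes> x" "z \<otimes> \<one>" "inv z"]
  by (simp add: prec_def)

text \<open>Conjugation by \<open>inv x\<close> moves the factor \<open>inv x\<close> in
  \<open>prec_inv_right\<close> to the other side.\<close>

lemma prec_inv_left:
  assumes "x \<in> carrier G" "y \<in> carrier G"
  shows "inv x \<prec> inv x \<otimes> y \<longleftrightarrow> x \<prec> y"
  using assms prec_inv_right[of x y] prec_conj[of "inv x" "y \<otimes> inv x" "inv x"]
  by (simp add: m_assoc)

lemma prec_asym:
  assumes "x \<prec> y" "x \<in> carrier G" "y \<in> carrier G"
  shows "\<not> y \<prec> x"
proof -
  have "\<forall>x\<in>carrier G. \<forall>y\<in>carrier G. \<forall>z\<in>carrier G. C x y z \<longrightarrow> \<not> C y x z"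
    using C_group unfolding C_group_def C_relation_on_def by blast
  then show ?thesis using assms unfolding prec_def by blast
qed

lemma prec_irrefl: "x \<in> carrier G \<Longrightarrow> \<not> x \<prec> x"
  using prec_asym by blast

text \<open>This is the third axiom at \<open>z = \<one>\<close>. Together with asymmetry it makes
  \<open>\<preceq>\<close> a total preorder.\<close>

lemma prec_cotrans:
  assumes "x \<prec> y" "x \<in> carrier G" "y \<in> carrier G" "w \<in> carrier G"
  shows "x \<prec> w \<or> w \<prec> y"
proof -
  have "\<forall>x\<in>carrier G. \<forall>y\<in>carrier G. \<forall>z\<in>carrier G. \<forall>w\<in>carrier G. C x y z \<longrightarrow> C w y z \<or> C x w z"
    using C_group unfolding C_group_def C_relation_on_def by blast
  then show ?thesis using assms unfolding prec_def by blast
qed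

lemma prec_trans:
  assumes "x \<prec> y" "y \<prec> z" "x \<in> carrier G" "y \<in> carrier G" "z \<in> carrier G"
  shows "x \<prec> z"
  using assms prec_asym prec_cotrans by blast

lemma preceq_trans:
  fixes x y z
  assumes "x \<preceq> y" "y \<preceq> z" "x \<in> carrier G" "y \<in> carrier G" "z \<in> carrier G"
  shows "x \<preceq> z"
  using assms prec_cotrans by blast

lemma one_prec:
  assumes "x \<in> carrier G" "x \<noteq> \<one>"
  shows "\<one> \<prec> x"
proof -
  have "\<forall>x\<in>carrier G. \<forall>y\<in>carrier G. x \<noteq> y \<longrightarrow> C x y y"
    using C_group unfolding C_group_def C_relation_on_def by blast
  then show ?thesis using assms unfolding prec_def by blast
qed

text \<open>By \<open>prec_inv_left\<close>, the hypothesis and the negated conclusion become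
  opposite strict comparisons of \<open>inv x\<close> and \<open>inv x \<otimes> y\<close>.\<close>

lemma inv_preceq_mult:
  assumes "x \<prec> y" "x \<in> carrier G" "y \<in> carrier G"
  shows "inv y \<preceq> inv y \<otimes> x"
proof
  assume "inv y \<otimes> x \<prec> inv y"
  then have "inv (inv y \<otimes> x) \<prec> inv (inv y \<otimes> x) \<otimes> inv y"
    using prec_inv_left[of "inv y \<otimes> x" "inv y"] assms by simp
  then have "inv x \<otimes> y \<prec> inv x"
    using assms by (simp add: inv_mult_group m_assoc)
  moreover have "inv x \<prec> inv x \<otimes> y"
    using assms prec_inv_left by blast
  ultimately show False
    using assms prec_asym by blast
qed

text \<open>Otherwise \<open>y \<preceq> y \<otimes> x \<preceq> x\<close>, against
  \<open>x \<prec> y\<close>. The second comparison is a translate of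
  \<open>y \<preceq> inv x\<close>; the first comes from \<open>x \<prec> inv y\<close>.\<close>

lemma inv_prec:
  assumes "x \<prec> y" "y \<preceq> inv y" "x \<in> carrier G" "y \<in> carrier G"
  shows "inv x \<prec> y"
proof (rule ccontr)
  assume "\<not> inv x \<prec> y"
  then have "y \<otimes> x \<preceq> x"
    using prec_inv_right[of "inv x" y] assms by simp
  moreover have "x \<prec> inv y"
    using assms prec_cotrans by blast
  then have "y \<preceq> y \<otimes> x"
    using inv_preceq_mult[of x "inv y"] assms by simp
  ultimately show False
    using assms preceq_trans[where x = y and y = "y \<otimes> x" and z = x] by blast
qed

section \<open>The smaller of \<open>x\<close> and \<open>inv x\<close>, and the orders built from
  it\<close>

definition lower :: "'a \<Rightarrow> 'a" where
  "lower x = (if inv x \<prec> x then inv x else x)"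

definition balanced :: "'a \<Rightarrow> bool" where
  "balanced x \<longleftrightarrow> inv x \<preceq> x \<and> x \<preceq> inv x"

text \<open>
  The second disjunct is essential: an unbalanced element \<open>y\<close> with \<open>y \<prec> inv y\<close> may be \<open>\<prec>\<close>-equivalent
  to a balanced one, although the two must get different values.
\<close>

definition fine :: "'a \<Rightarrow> 'a \<Rightarrow> bool" where
  "fine x y \<longleftrightarrow> lower x \<prec> lower y \<or> lower x \<preceq> lower y \<and> balanced x \<and> \<not> balanced y"

text \<open>\<open>coarse x y\<close> is going to mean \<open>v(x) > v(y)\<close>: the orders are opposite.\<close>

definition coarse :: "'a \<Rightarrow> 'a \<Rightarrow> bool" where
  "coarse x y \<longleftrightarrow> fine x y \<and>
     (x = \<one> \<or> (\<exists>n\<in>carrier G. \<not> balanced n \<and> \<not> fine n x \<and> \<not> fine y n))"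

lemma lower_closed [simp]: "x \<in> carrier G \<Longrightarrow> lower x \<in> carrier G"
  by (simp add: lower_def)

lemma lower_preceq:
  assumes "x \<in> carrier G"
  shows "lower x \<preceq> x" "lower x \<preceq> inv x" "lower x \<preceq> inv (lower x)"
  using assms prec_asym prec_irrefl by (auto simp: lower_def)

lemma lower_cases: "lower x = x \<or> lower x = inv x"
  by (simp add: lower_def)

lemma balanced_inv [simp]: "x \<in> carrier G \<Longrightarrow> balanced (inv x) \<longleftrightarrow> balanced x"
  by (auto simp: balanced_def)

lemma lower_balanced: "balanced x \<Longrightarrow> lower x = x"
  by (auto simp: balanced_def lower_def)

text \<open>On a tie \<open>lower\<close> keeps its argument, so \<open>lower (inv x)\<close> and
  \<open>lower x\<close> are in general only \<open>\<prec>\<close>-equivalent.\<close>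

lemma lower_inv:
  assumes "x \<in> carrier G" "y \<in> carrier G"
  shows "lower (inv x) \<prec> y \<longleftrightarrow> lower x \<prec> y" "y \<prec> lower (inv x) \<longleftrightarrow> y \<prec> lower x"
proof -
  have "lower x \<preceq> lower (inv x)" "lower (inv x) \<preceq> lower x"
    using assms prec_irrefl prec_asym by (auto simp: lower_def)
  then show "lower (inv x) \<prec> y \<longleftrightarrow> lower x \<prec> y" "y \<prec> lower (inv x) \<longleftrightarrow> y \<prec> lower x"
    using assms prec_cotrans by (meson inv_closed lower_closed)+
qed

lemma fine_inv [simp]:
  assumes "x \<in> carrier G" "y \<in> carrier G"
  shows "fine (inv x) y \<longleftrightarrow> fine x y" "fine x (inv y) \<longleftrightarrow> fine x y"
  using assms by (auto simp: fine_def lower_inv)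

lemma lower_conj:
  assumes "x \<in> carrier G" "z \<in> carrier G"
  shows "lower (z \<otimes> x \<otimes> inv z) = z \<otimes> lower x \<otimes> inv z"
    "balanced (z \<otimes> x \<otimes> inv z) \<longleftrightarrow> balanced x"
proof -
  have "inv (z \<otimes> x \<otimes> inv z) = z \<otimes> inv x \<otimes> inv z"
    using assms by (simp add: inv_mult_group m_assoc)
  then show "lower (z \<otimes> x \<otimes> inv z) = z \<otimes> lower x \<otimes> inv z"
    "balanced (z \<otimes> x \<otimes> inv z) \<longleftrightarrow> balanced x"
    using assms by (auto simp: lower_def balanced_def prec_conj)
qed

lemma fine_conj:
  assumes "x \<in> carrier G" "y \<in> carrier G" "z \<in> carrier G"
  shows "fine (z \<otimes> x \<otimes> inv z) (z \<otimes> y \<otimes> inv z) \<longleftrightarrow> fine x y"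
  using assms by (simp add: fine_def lower_conj prec_conj)

lemma fine_asym:
  assumes "fine x y" "x \<in> carrier G" "y \<in> carrier G"
  shows "\<not> fine y x"
  using assms prec_asym[of "lower x" "lower y"] by (auto simp: fine_def)

text \<open>\<open>fine\<close> combines two strict weak orders lexicographically, first by
  \<open>lower\<close>, then by being balanced; such a combination is again a strict weak
  order.\<close>

lemma fine_cotrans:
  assumes "fine x y" "x \<in> carrier G" "y \<in> carrier G" "w \<in> carrier G"
  shows "fine x w \<or> fine w y"
  using assms prec_cotrans[of "lower x" "lower y" "lower w"]
    prec_cotrans[of "lower w" "lower x" "lower y"] prec_cotrans[of "lower y" "lower w" "lower x"]
    prec_asym[of "lower x" "lower y"] prec_asym[of "lower x" "lower w"] prec_asym[of "lower w" "lower y"]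
  unfolding fine_def lower_closed by (metis lower_closed)

lemma fine_one:
  assumes "x \<in> carrier G" "x \<noteq> \<one>"
  shows "fine \<one> x"
proof -
  have "lower \<one> = \<one>" by (simp add: lower_def)
  moreover have "lower x \<noteq> \<one>"
    using assms by (simp add: lower_def)
  ultimately show ?thesis
    using assms one_prec by (simp add: fine_def)
qed

section \<open>The ultrametric inequality for \<open>fine\<close>\<close>

lemma lower_mult_preceq:
  assumes "x \<in> carrier G" "y \<in> carrier G"
  shows "lower (x \<otimes> inv y) \<preceq> lower x \<or> lower (x \<otimes> inv y) \<preceq> lower y"
proof (rule ccontr)
  define t where "t = lower (x \<otimes> inv y)"
  assume "\<not> ?thesis"
  then have t: "lower x \<prec> t" "lower y \<prec> t" by (auto simp: t_def)
  have [simp]: "inv (x \<otimes> inv y) = y \<otimes> inv x" "t \<in> carrier G"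
    using assms by (simp_all add: inv_mult_group t_def)
  have le: "t \<preceq> x \<otimes> inv y" "t \<preceq> y \<otimes> inv x"
    using lower_preceq(1,2)[of "x \<otimes> inv y"] assms by (simp_all add: t_def)
  have 1: "t \<preceq> inv y" if "x \<preceq> y"
    using that prec_inv_right[of y x] preceq_trans[OF le(1)] assms by simp
  have 2: "t \<preceq> inv x" if "y \<preceq> x"
    using that prec_inv_right[of x y] preceq_trans[OF le(2)] assms by simp
  have 3: "t \<preceq> x" if "inv y \<preceq> inv x"
    using that prec_inv_left[of "inv x" "inv y"] preceq_trans[OF le(1)] assms by simp
  have 4: "t \<preceq> y" if "inv x \<preceq> inv y"
    using that prec_inv_left[of "inv y" "inv x"] preceq_trans[OF le(2)] assms by simp
  \<comment> \<open>By symmetry let \<open>x \<preceq> y\<close>. Then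
    \<open>t \<preceq> inv y\<close> by \<open>1\<close>, so \<open>lower y \<prec> t\<close> forces
    \<open>y \<prec> t\<close>, hence also \<open>x \<prec> t\<close>. But comparing
    \<open>inv x\<close> with \<open>inv y\<close> gives \<open>t \<preceq> x\<close> or
    \<open>t \<preceq> y\<close> by \<open>3\<close> and \<open>4\<close>.\<close>
  show False
    using t 1 2 3 4 assms prec_asym prec_cotrans unfolding lower_def
    by (smt (verit) inv_closed \<open>t \<in> carrier G\<close>)
qed

text \<open>\<open>lower_mult_preceq\<close> leaves only the tie-break to consider: \<open>y\<close>
  balanced, \<open>t = x \<otimes> inv y\<close> unbalanced, with \<open>lower t\<close> equivalent
  to \<open>y\<close>. Then \<open>t\<close> and \<open>inv t\<close> both turn out to be equivalent
  to \<open>y\<close>, so \<open>t\<close> is balanced after all.\<close>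

lemma fine_mult_aux:
  assumes "\<not> fine y x" "x \<in> carrier G" "y \<in> carrier G"
  shows "\<not> fine y (x \<otimes> inv y)"
proof
  define t where "t = x \<otimes> inv y"
  have t [simp]: "t \<in> carrier G" "inv t = y \<otimes> inv x"
    using assms by (simp_all add: t_def inv_mult_group)
  assume "fine y (x \<otimes> inv y)"
  then have f: "fine y t" by (simp add: t_def)
  have "lower x \<preceq> lower y"
    using assms(1) by (auto simp: fine_def)
  then have "lower t \<preceq> lower y"
    using lower_mult_preceq[of x y] assms preceq_trans[where x = "lower t" and y = "lower x" and z = "lower y"]
    by (auto simp: t_def)
  with f have y: "balanced y" "\<not> balanced t" "lower y \<preceq> lower t"
    by (auto simp: fine_def)
  have ly: "lower y = y" using y(1) by (rule lower_balanced)
  have yi: "y \<preceq> inv y" "inv y \<preceq> y" using y(1) by (auto simp: balanced_def)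
  have "x \<preceq> y \<and> inv x \<preceq> y"
  \<comment> \<open>A strict comparison extends to both \<open>x\<close> and \<open>inv x\<close> by
    \<open>inv_prec\<close>; on a tie, the hypothesis makes \<open>x\<close> balanced like
    \<open>y\<close>.\<close>
  proof (cases "lower x \<prec> y")
    case True
    then have "inv (lower x) \<prec> y" using inv_prec[of "lower x" y] yi assms by simp
    with True have "x \<prec> y \<and> inv x \<prec> y" using lower_cases[of x] assms by auto
    then show ?thesis using assms prec_asym by blast
  next
    case False
    then have "balanced x" using assms(1) y(1) ly by (auto simp: fine_def)
    moreover from this have "x \<preceq> y"
      using \<open>lower x \<preceq> lower y\<close> ly lower_balanced by simp
    ultimately show ?thesis
      using assms preceq_trans[where x = "inv x" and y = x and z = y] by (auto simp: balanced_def)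
  qed
  then have x: "x \<preceq> y" "inv x \<preceq> inv y"
    using preceq_trans[where x = "inv x" and y = y and z = "inv y"] yi assms by auto
  have "t \<preceq> inv y" "inv t \<preceq> y"
    using x prec_inv_right[of y x] prec_inv_left[of "inv y" "inv x"] assms by (auto simp: t_def inv_mult_group)
  then have "t \<preceq> y" "inv t \<preceq> y"
    using preceq_trans[where x = t and y = "inv y" and z = y] yi assms by auto
  moreover have "y \<preceq> t" "y \<preceq> inv t"
    using y(3) ly lower_preceq(1,2)[of t] preceq_trans[where x = y and y = "lower t"] assms t(1)
    by (metis inv_closed lower_closed)+
  ultimately have "balanced t"
    unfolding balanced_def using assms preceq_trans t(1) by (meson inv_closed)
  with y show False by simp
qed

text \<open>Whichever of \<open>x\<close> and \<open>y\<close> has the smaller value bounds the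
  value of \<open>x \<otimes> inv y\<close> from below, and \<open>fine_cotrans\<close> carries the
  bound over to \<open>z\<close>. Passing to the inverse exchanges the roles of \<open>x\<close> and
  \<open>y\<close>.\<close>

lemma fine_mult:
  assumes "fine z (x \<otimes> inv y)" "x \<in> carrier G" "y \<in> carrier G" "z \<in> carrier G"
  shows "fine z x \<or> fine z y"
proof (rule ccontr)
  assume n: "\<not> ?thesis"
  show False
  proof (cases "fine y x")
    case False
    then have "\<not> fine y (x \<otimes> inv y)" using fine_mult_aux assms by blast
    with n show False using assms fine_cotrans[of z "x \<otimes> inv y" y] by auto
  next
    case True
    then have "\<not> fine x (y \<otimes> inv x)" using fine_mult_aux assms fine_asym by blast
    moreover have "y \<otimes> inv x = inv (x \<otimes> inv y)" using assms by (simp add: inv_mult_group)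
    ultimately have "\<not> fine x (x \<otimes> inv y)" using assms by simp
    with n show False using assms fine_cotrans[of z "x \<otimes> inv y" x] by auto
  qed
qed

text \<open>By \<open>prec_inv_right\<close> the conclusion amounts to
  \<open>k \<otimes> x \<preceq> x\<close>, and it is used in this form.\<close>

lemma fine_preceq_inv:
  assumes "fine k x" "k \<in> carrier G" "x \<in> carrier G"
  shows "k \<preceq> inv x"
proof (cases "lower k \<prec> lower x")
  case True
  then have "inv (lower k) \<prec> lower x"
    using inv_prec[of "lower k" "lower x"] lower_preceq(3)[of x] assms by simp
  with True have "k \<prec> lower x"
    using lower_cases[of k] assms by auto
  then show ?thesis
    using assms lower_preceq(2)[of x] prec_asym[of k "lower x"] preceq_trans[where x = k and y = "lower x" and z = "inv x"] by simp
next
  case False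
  then have "balanced k" "lower k \<preceq> lower x" using assms(1) by (auto simp: fine_def)
  then show ?thesis
    using assms lower_preceq(2)[of x] preceq_trans[where x = k and y = "lower x" and z = "inv x"] lower_balanced by simp
qed

text \<open>Multiplying by an element of larger value does not change the
  \<open>\<prec>\<close>-class; this lets \<open>\<prec>\<close> descend to the quotients. The
  second comparison is the first one for \<open>inv k\<close> and
  \<open>k \<otimes> x\<close>.\<close>

lemma mult_fine_equiv:
  assumes "fine k x" "k \<in> carrier G" "x \<in> carrier G"
  shows "k \<otimes> x \<preceq> x" "x \<preceq> k \<otimes> x"
proof -
  have *: "k \<otimes> x \<preceq> x" if "fine k x" "k \<in> carrier G" "x \<in> carrier G" for k x
    using that fine_preceq_inv[OF that] prec_inv_right[of "inv x" k] by simp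
  show "k \<otimes> x \<preceq> x" using * assms by blast
  \<comment> \<open>If \<open>k \<otimes> x\<close> had at least the value of \<open>k\<close>, so
    would \<open>x = inv k \<otimes> (k \<otimes> x)\<close>.\<close>
  have "fine k (k \<otimes> x)"
  proof (rule ccontr)
    assume "\<not> fine k (k \<otimes> x)"
    have "\<not> fine k (inv k)" using assms fine_asym by simp blast
    moreover have "\<not> fine k (inv (k \<otimes> x))" using \<open>\<not> fine k (k \<otimes> x)\<close> assms by simp
    ultimately have "\<not> fine k (inv k \<otimes> inv (inv (k \<otimes> x)))"
      using fine_mult[of k "inv k" "inv (k \<otimes> x)"] assms by blast
    then show False using assms by (simp add: m_assoc[symmetric])
  qed
  then have "inv k \<otimes> (k \<otimes> x) \<preceq> k \<otimes> x"
    using *[of "inv k" "k \<otimes> x"] assms by simp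
  then show "x \<preceq> k \<otimes> x"
    using assms by (simp add: m_assoc[symmetric])
qed

section \<open>Merging of balanced values\<close>

lemma coarse_asym:
  assumes "coarse x y" "x \<in> carrier G" "y \<in> carrier G"
  shows "\<not> coarse y x"
  using assms fine_asym unfolding coarse_def by blast

lemma coarse_one: "x \<in> carrier G \<Longrightarrow> x \<noteq> \<one> \<Longrightarrow> coarse \<one> x"
  using fine_one by (simp add: coarse_def)

text \<open>The unbalanced \<open>n\<close> that separates \<open>x\<close> from \<open>y\<close>
  also separates \<open>x\<close> from \<open>w\<close> or \<open>w\<close> from \<open>y\<close>,
  depending on the side of \<open>n\<close> on which \<open>w\<close> lies.\<close>

lemma coarse_cotrans:
  assumes "coarse x y" "x \<in> carrier G" "y \<in> carrier G" "w \<in> carrier G"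
  shows "coarse x w \<or> coarse w y"
proof (cases "x = \<one>")
  case True
  then show ?thesis using assms coarse_one by metis
next
  case False
  then obtain n where n: "n \<in> carrier G" "\<not> balanced n" "\<not> fine n x" "\<not> fine y n" and xy: "fine x y"
    using assms(1) by (auto simp: coarse_def)
  show ?thesis
  proof (cases "fine w y")
    case wy: True
    show ?thesis
    proof (cases "fine n w")
      case True
      then have "fine x w" using n assms fine_cotrans by blast
      moreover have "\<not> fine w n" using True fine_asym n assms by blast
      ultimately show ?thesis using n by (auto simp: coarse_def)
    next
      case False
      then show ?thesis using wy n by (auto simp: coarse_def)
    qed
  next
    case False
    then have "fine x w" using xy assms fine_cotrans by blast
    moreover have "\<not> fine w n" using False n assms fine_cotrans by blast
    ultimately show ?thesis using n by (auto simp: coarse_def)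
  qed
qed

lemma coarse_conj:
  assumes "coarse x y" "x \<in> carrier G" "y \<in> carrier G" "z \<in> carrier G"
  shows "coarse (z \<otimes> x \<otimes> inv z) (z \<otimes> y \<otimes> inv z)"
proof (cases "x = \<one>")
  case True
  then show ?thesis using assms by (simp add: coarse_def) (metis assms(1) coarse_def fine_conj one_closed r_inv r_one)
next
  case False
  then obtain n where n: "n \<in> carrier G" "\<not> balanced n" "\<not> fine n x" "\<not> fine y n" and xy: "fine x y"
    using assms(1) by (auto simp: coarse_def)
  then show ?thesis unfolding coarse_def
    using assms by (intro conjI disjI2 bexI[of _ "z \<otimes> n \<otimes> inv z"]) (simp_all add: fine_conj lower_conj)
qed

lemma fine_if_coarse: "coarse x y \<Longrightarrow> fine x y"
  by (simp add: coarse_def)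

lemma coarse_fine:
  assumes "coarse x y" "\<not> fine z y" "x \<in> carrier G" "y \<in> carrier G" "z \<in> carrier G"
  shows "coarse x z"
  using assms coarse_cotrans fine_if_coarse by blast

text \<open>The inequality for \<open>fine\<close> suffices: in that order
  \<open>x \<otimes> inv y\<close> has at least the value of \<open>x\<close> or of
  \<open>y\<close>, and merging values preserves weak inequalities.\<close>

lemma coarse_mult:
  assumes "coarse z (x \<otimes> inv y)" "x \<in> carrier G" "y \<in> carrier G" "z \<in> carrier G"
  shows "coarse z x \<or> coarse z y"
proof -
  have "\<not> fine x (x \<otimes> inv y) \<or> \<not> fine y (x \<otimes> inv y)"
  proof (cases "fine x y")
    case True
    then have "\<not> fine y x" "\<not> fine y y" using assms fine_asym by blast+
    then show ?thesis using fine_mult[of y x y] assms by blast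
  next
    case False
    then have "\<not> fine x x" "\<not> fine x y" using assms fine_asym by blast+
    then show ?thesis using fine_mult[of x x y] assms by blast
  qed
  then show ?thesis
    using assms coarse_fine[of z "x \<otimes> inv y"] by blast
qed

text \<open>The unbalanced one of \<open>x\<close> and \<open>y\<close> is itself the required
  \<open>n\<close>, so merging affects balanced values only.\<close>

lemma coarse_unbalanced_iff:
  assumes "x \<in> carrier G" "y \<in> carrier G" "\<not> balanced x \<or> \<not> balanced y"
  shows "coarse x y \<longleftrightarrow> fine x y"
  using assms fine_asym unfolding coarse_def by metis

lemma fine_equiv:
  assumes "\<not> fine x y" "\<not> fine y x"
  shows "balanced x \<longleftrightarrow> balanced y" "lower x \<preceq> lower y"
  using assms by (auto simp: fine_def)

text \<open>Makes being balanced a property of the value; it decides the type of the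
  quotient.\<close>

lemma coarse_equiv_balanced:
  assumes "\<not> coarse x y" "\<not> coarse y x" "x \<in> carrier G" "y \<in> carrier G"
  shows "balanced x \<longleftrightarrow> balanced y"
  using assms fine_equiv coarse_unbalanced_iff by blast

section \<open>Criteria for a C-relation to be of elementary type\<close>

lemma valuational_if_balanced:
  assumes "\<And>x. x \<in> carrier G \<Longrightarrow> balanced x"
  shows "valuational G C"
proof -
  \<comment> \<open>When everything is balanced, \<open>lower\<close> is the identity, and
    \<open>lower_mult_preceq\<close> becomes the ultrametric inequality for \<open>\<prec>\<close>
    itself.\<close>
  have mult: "z \<prec> x \<or> z \<prec> y"
    if "z \<prec> x \<otimes> inv y" "x \<in> carrier G" "y \<in> carrier G" "z \<in> carrier G" for x y z
    using lower_mult_preceq[of x y] prec_cotrans[of z "x \<otimes> inv y"] that assms lower_balanced by auto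
  have "\<exists>(\<Gamma> :: 'a set set) r v. valuation G \<Gamma> r v \<and> v ` carrier G = insert None (Some ` \<Gamma>) \<and>
    (\<forall>x\<in>carrier G. \<forall>y\<in>carrier G. val_le r (v x) (v y) \<longleftrightarrow> \<not> x \<prec> y) \<and>
    (\<forall>x\<in>carrier G. \<forall>y\<in>carrier G. val_less r (v x) (v y) \<longleftrightarrow> y \<prec> x)"
    by (rule valuation_from_strict_weak_order)
      (rule prec_asym prec_cotrans one_prec mult iffD2[OF prec_conj]; assumption)+
  then obtain \<Gamma> :: "'a set set" and r v where "valuation G \<Gamma> r v"
    "\<forall>x\<in>carrier G. \<forall>y\<in>carrier G. val_less r (v x) (v y) \<longleftrightarrow> y \<prec> x"
    by blast
  then have "valuation_C G r v C" "valuation G \<Gamma> r v"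
    by (simp_all add: valuation_C_def C_iff_prec)
  then show ?thesis unfolding valuational_def by blast
qed

text \<open>An element and its inverse have the same value, so neither precedes the other. The
  alternation clause assumes valuational quotients, and this converse turns them back into balanced
  values.\<close>

lemma balanced_if_valuational:
  assumes "valuational G C" "x \<in> carrier G"
  shows "balanced x"
proof -
  obtain \<Gamma> :: "'a set set" and r v where v: "valuation G \<Gamma> r v" "valuation_C G r v C"
    using assms unfolding valuational_def by blast
  have le: "val_le r (v x) (v (inv x))" if x: "x \<in> carrier G" for x
  proof -
    have "val_le r (val_min r (v \<one>) (v x)) (v (\<one> \<otimes> inv x))" "v \<one> = None"
      using v(1) x unfolding valuation_def by blast+
    then show ?thesis
      using x by (auto simp: val_min_def val_le_def)
  qed
  have "antisym r" using v(1) by (auto simp: valuation_def order_on_defs)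
  then have "v x = v (inv x)"
    using le[of x] le[of "inv x"] assms by (auto simp: val_le_def dest: antisymD)
  then show ?thesis
    using v(2) assms by (simp add: valuation_C_def balanced_def prec_def val_less_def)
qed

text \<open>The elements with \<open>inv x \<prec> x\<close> form the positive cone. By the
  hypothesis on \<open>lower\<close>, all negative elements are \<open>\<prec>\<close>-equivalent,
  as an order-type relation requires.\<close>

lemma order_type_if_unbalanced:
  assumes unb: "\<And>x. x \<in> carrier G \<Longrightarrow> x \<noteq> \<one> \<Longrightarrow> \<not> balanced x"
    and lower: "\<And>x y. x \<in> carrier G \<Longrightarrow> x \<noteq> \<one> \<Longrightarrow> y \<in> carrier G \<Longrightarrow> y \<noteq> \<one> \<Longrightarrow> lower x \<preceq> lower y"
  shows "order_type G C"
proof -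
  define pos where "pos x \<longleftrightarrow> inv x \<prec> x" for x
  define r where "r = {(x, y). x \<in> carrier G \<and> y \<in> carrier G \<and> (x = y \<or> pos (y \<otimes> inv x))}"
  have not_one: "x \<noteq> \<one>" if "pos x" for x
    using that prec_irrefl by (auto simp: pos_def)
  have pos_inv: "pos (inv x) \<longleftrightarrow> \<not> pos x" if "x \<in> carrier G" "x \<noteq> \<one>" for x
    using that unb[of x] prec_asym[of x "inv x"] by (auto simp: pos_def balanced_def)
  have lower_eq: "lower x = (if pos x then inv x else x)" for x
    by (simp add: pos_def lower_def)
  have lt: "inv y \<prec> x" if "pos x" "pos y" "x \<in> carrier G" "y \<in> carrier G" for x y
  proof -
    have "inv y \<preceq> inv x" using lower[of y x] that not_one by (simp add: lower_eq)
    moreover have "inv x \<prec> x" using that by (simp add: pos_def)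
    ultimately show ?thesis using prec_cotrans[of "inv x" x "inv y"] that by blast
  qed
  \<comment> \<open>Translating \<open>inv y \<prec> x\<close> gives
    \<open>inv y \<prec> y \<prec> x \<otimes> y\<close>, whereas a negative
    \<open>x \<otimes> y\<close> would be equivalent to the negative \<open>inv y\<close>.\<close>
  have pos_mult: "pos (x \<otimes> y)" if "pos x" "pos y" "x \<in> carrier G" "y \<in> carrier G" for x y
  proof (rule ccontr)
    assume neg: "\<not> pos (x \<otimes> y)"
    have "y \<prec> x \<otimes> y" using lt[OF that] prec_inv_right[of "inv y" x] that by simp
    moreover have "inv y \<prec> y" using that by (simp add: pos_def)
    ultimately have less: "inv y \<prec> x \<otimes> y" using prec_trans[of "inv y" y "x \<otimes> y"] that by simp
    have "x \<otimes> y \<noteq> \<one>"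
      using less that one_prec[of "inv y"] prec_asym[of \<one> "inv y"] prec_irrefl[of \<one>] not_one[of y]
      by auto
    then have "x \<otimes> y \<preceq> inv y" using lower[of "x \<otimes> y" y] neg that not_one by (simp add: lower_eq)
    with less show False by simp
  qed
  have pos_conj: "pos (z \<otimes> x \<otimes> inv z) \<longleftrightarrow> pos x" if "x \<in> carrier G" "z \<in> carrier G" for x z
    using that prec_conj[of "inv x" x z] by (simp add: pos_def inv_mult_group m_assoc)
  have strict: "(x, y) \<in> r \<and> x \<noteq> y \<longleftrightarrow> pos (y \<otimes> inv x)" if "x \<in> carrier G" "y \<in> carrier G" for x y
    using that not_one[of "y \<otimes> inv x"] by (auto simp: r_def)
  have eq: "x = y" if "x \<otimes> inv y = \<one>" "x \<in> carrier G" "y \<in> carrier G" for x y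
    using that inv_solve_right[of \<one> x y] by simp
  have flip: "pos (x \<otimes> inv y) \<longleftrightarrow> \<not> pos (y \<otimes> inv x)" if "x \<in> carrier G" "y \<in> carrier G" "x \<noteq> y" for x y
    using that pos_inv[of "y \<otimes> inv x"] eq[of y x] by (auto simp: inv_mult_group)
  have chain: "pos (z \<otimes> inv x)"
    if "pos (y \<otimes> inv x)" "pos (z \<otimes> inv y)" "x \<in> carrier G" "y \<in> carrier G" "z \<in> carrier G" for x y z
  proof -
    have "z \<otimes> inv y \<otimes> (y \<otimes> inv x) = z \<otimes> inv x"
      using that by (simp add: m_assoc mult_inv_cancel)
    then show ?thesis using pos_mult[of "z \<otimes> inv y" "y \<otimes> inv x"] that by simp
  qed
  have "linear_order_on (carrier G) r"
    unfolding order_on_defs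
  proof (intro conjI)
    show "trans r"
      unfolding trans_def r_def using chain by blast
    show "antisym r"
      unfolding antisym_def r_def using flip by blast
    show "total_on (carrier G) r"
      unfolding total_on_def r_def using flip by blast
  qed (auto simp: r_def refl_on_def)
  moreover have "(x \<otimes> z, y \<otimes> z) \<in> r \<and> (z \<otimes> x, z \<otimes> y) \<in> r"
    if "(x, y) \<in> r" "x \<in> carrier G" "y \<in> carrier G" "z \<in> carrier G" for x y z
  proof -
    have "y \<otimes> z \<otimes> inv (x \<otimes> z) = y \<otimes> inv x" "z \<otimes> y \<otimes> inv (z \<otimes> x) = z \<otimes> (y \<otimes> inv x) \<otimes> inv z"
      using that by (simp_all add: inv_mult_group m_assoc mult_inv_cancel)
    then show ?thesis using that pos_conj[of "y \<otimes> inv x" z] by (auto simp: r_def)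
  qed
  ultimately have bi: "bi_order_on G r" by (auto simp: bi_order_on_def)
  \<comment> \<open>The right side is the order-type formula at \<open>z = \<one>\<close>:
    \<open>u < w\<close> and \<open>\<one> < w\<close>, or \<open>u = \<one> \<noteq> w\<close>.
    Translation by \<open>inv z\<close> then yields the general formula.\<close>
  have prec_iff: "u \<prec> w \<longleftrightarrow> pos (w \<otimes> inv u) \<and> pos w \<or> u = \<one> \<and> w \<noteq> \<one>"
    if u: "u \<in> carrier G" and w: "w \<in> carrier G" for u w
  proof (cases "u = \<one> \<or> w = \<one>")
    case True
    then show ?thesis
      using u w one_prec[of w] one_prec[of u] prec_asym[of \<one> u] prec_irrefl[of \<one>] not_one[of w] by auto
  next
    case False
    define p where "p = w \<otimes> inv u"
    have p: "p \<in> carrier G" using u w by (simp add: p_def)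
    \<comment> \<open>The pair \<open>inv u\<close>, \<open>p\<close> compares like
      \<open>u\<close>, \<open>w\<close>. So the argument for \<open>pos w\<close> also yields
      \<open>pos p\<close>, and conversely \<open>lt\<close> applies to \<open>p\<close> if
      \<open>u\<close> is positive and to \<open>w\<close> if \<open>u\<close> is negative.\<close>
    have up: "inv u \<prec> p \<longleftrightarrow> u \<prec> w" using prec_inv_right u w by (simp add: p_def)
    show ?thesis
    proof
      assume uw: "u \<prec> w"
      have "pos w"
      proof (rule ccontr)
        assume "\<not> pos w"
        then have "w \<preceq> lower u" using lower[of w u] False u w by (simp add: lower_eq)
        then show False using uw lower_preceq(1)[of u] preceq_trans[where x = w and y = "lower u" and z = u] u w by simp
      qed
      moreover have "pos p"
      proof (rule ccontr)
        assume "\<not> pos p"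
        moreover have "p \<noteq> \<one>" using uw up one_prec[of "inv u"] prec_asym[of \<one> "inv u"] False u by auto
        ultimately have "p \<preceq> lower u" using lower[of p u] False u p by (simp add: lower_eq)
        then show False
          using uw up lower_preceq(2)[of u] preceq_trans[where x = p and y = "lower u" and z = "inv u"] u p by simp
      qed
      ultimately show "pos (w \<otimes> inv u) \<and> pos w \<or> u = \<one> \<and> w \<noteq> \<one>" by (simp add: p_def)
    next
      assume "pos (w \<otimes> inv u) \<and> pos w \<or> u = \<one> \<and> w \<noteq> \<one>"
      then have pp: "pos p" "pos w" using False by (auto simp: p_def)
      show "u \<prec> w"
      proof (cases "pos u")
        case True
        then show ?thesis using lt[of p u] pp p u up by simp
      next
        case neg: False
        then have "pos (inv u)" using pos_inv False u by blast
        then show ?thesis using lt[of w "inv u"] pp u w by simp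
      qed
    qed
  qed
  have "C x y z \<longleftrightarrow> ((y, x) \<in> r \<and> y \<noteq> x \<and> (z, x) \<in> r \<and> z \<noteq> x) \<or> (y = z \<and> z \<noteq> x)"
    if xyz: "x \<in> carrier G" "y \<in> carrier G" "z \<in> carrier G" for x y z
  proof -
    have "x \<otimes> inv z \<otimes> inv (y \<otimes> inv z) = x \<otimes> inv y"
      using xyz by (simp add: inv_mult_group m_assoc mult_inv_cancel)
    moreover have "y \<otimes> inv z = \<one> \<longleftrightarrow> y = z" "x \<otimes> inv z = \<one> \<longleftrightarrow> x = z"
      using xyz eq r_inv by metis+
    ultimately show ?thesis
      using xyz strict[of y x] strict[of z x] prec_iff[of "y \<otimes> inv z" "x \<otimes> inv z"]
      by (auto simp: C_iff_prec)
  qed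
  with bi show ?thesis unfolding order_type_def by blast
qed

end

section \<open>Quotients of C-groups\<close>

text \<open>The conditions \<open>fh\<^sup>-\<^sup>1 \<notin> G\<^sub>\<gamma>\<close> and \<open>gh\<^sup>-\<^sup>1 \<in> G\<^sub>\<gamma>\<close> of \<open>C\<^sub>\<gamma>\<close> become comparisons of cosets.\<close>

definition quotient_C :: "('a \<Rightarrow> 'a \<Rightarrow> 'a \<Rightarrow> bool) \<Rightarrow> 'a set \<Rightarrow> 'a set \<Rightarrow> 'a set \<Rightarrow> bool" where
  "quotient_C C X Y Z \<longleftrightarrow> X \<noteq> Z \<and> (Y = Z \<or> (\<exists>f\<in>X. \<exists>g\<in>Y. \<exists>h\<in>Z. C f g h))"

text \<open>By \<open>saturated\<close>, each coset other than \<open>H\<close> lies in a single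
  \<open>\<prec>\<close>-class; this makes the induced relation independent of
  representatives.\<close>

locale c_quotient = c_group G C + normal H G for G :: "('a, 'b) monoid_scheme" (structure) and C H +
  assumes saturated: "x \<in> carrier G \<Longrightarrow> x \<notin> H \<Longrightarrow> k \<in> H \<Longrightarrow> k \<otimes> x \<preceq> x \<and> x \<preceq> k \<otimes> x"
begin

lemma rcos_eq_iff:
  assumes "x \<in> carrier G" "y \<in> carrier G"
  shows "H #> x = H #> y \<longleftrightarrow> x \<otimes> inv y \<in> H"
  using assms coset_mult_inv1[of H x y] coset_mult_inv2[of H x y] coset_join1[of H "x \<otimes> inv y"]
    coset_join2[of "x \<otimes> inv y" H] subset subgroup_axioms by blast

lemma rcos_eq_self_iff: "x \<in> carrier G \<Longrightarrow> H #> x = H \<longleftrightarrow> x \<in> H"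
  using coset_join1[of H x] coset_join2[of x H] subgroup_axioms by blast

lemma prec_rcos:
  assumes "H #> x = H #> x'" "H #> y = H #> y'" "x \<notin> H" "y \<notin> H" "x \<prec> y"
    "x \<in> carrier G" "y \<in> carrier G" "x' \<in> carrier G" "y' \<in> carrier G"
  shows "x' \<prec> y'"
proof -
  have *: "x \<preceq> x' \<and> x' \<preceq> x"
    if "H #> x = H #> x'" "x \<notin> H" "x \<in> carrier G" "x' \<in> carrier G" for x x'
  proof -
    have "x' \<otimes> inv x \<in> H" using that rcos_eq_iff[of x' x] by metis
    moreover have "x' \<otimes> inv x \<otimes> x = x'" using that by (simp add: m_assoc)
    ultimately show ?thesis using saturated[of x "x' \<otimes> inv x"] that by metis
  qed
  have "x' \<preceq> x" "y \<preceq> y'" using *[of x x'] *[of y y'] assms by blast+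
  then show ?thesis using assms prec_cotrans[of x y x'] prec_cotrans[of x' y y'] by blast
qed

lemma rcos_div_cong:
  assumes "H #> x = H #> x'" "H #> y = H #> y'"
    "x \<in> carrier G" "y \<in> carrier G" "x' \<in> carrier G" "y' \<in> carrier G"
  shows "H #> (x \<otimes> inv y) = H #> (x' \<otimes> inv y')"
proof -
  have "H #> inv y = H #> inv y'"
    using rcos_inv[of y] rcos_inv[of y'] assms by metis
  then show ?thesis using rcos_sum[of x "inv y"] rcos_sum[of x' "inv y'"] assms by (metis inv_closed)
qed

text \<open>The existential choice of representatives in \<open>quotient_C\<close> is harmless: away
  from \<open>H\<close>, \<open>prec_rcos\<close> carries the comparison of
  \<open>g' \<otimes> inv h'\<close> with \<open>f' \<otimes> inv h'\<close> over to any other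
  representatives.\<close>

lemma quotient_C_rcos:
  assumes f: "f \<in> carrier G" and g: "g \<in> carrier G" and h: "h \<in> carrier G"
  shows "quotient_C C (H #> f) (H #> g) (H #> h) \<longleftrightarrow>
    f \<otimes> inv h \<notin> H \<and> (g \<otimes> inv h \<in> H \<or> C f g h)"
proof -
  have "C f g h"
    if "f \<otimes> inv h \<notin> H" "g \<otimes> inv h \<notin> H" "f' \<in> H #> f" "g' \<in> H #> g" "h' \<in> H #> h" "C f' g' h'"
    for f' g' h'
  proof -
    have c: "f' \<in> carrier G" "g' \<in> carrier G" "h' \<in> carrier G"
      using that f g h r_coset_subset_G[OF subset] by blast+
    have e: "H #> f = H #> f'" "H #> g = H #> g'" "H #> h = H #> h'"
        using repr_independence f g h that subgroup_axioms by blast+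
    have n: "f' \<otimes> inv h' \<notin> H" "g' \<otimes> inv h' \<notin> H"
      using e that rcos_eq_iff f g h c by metis+
    have "g' \<otimes> inv h' \<prec> f' \<otimes> inv h'" using that c by (simp add: C_iff_prec)
    then have "g \<otimes> inv h \<prec> f \<otimes> inv h"
      using prec_rcos[OF rcos_div_cong[OF e(2)[symmetric] e(3)[symmetric] c(2,3) g h]
          rcos_div_cong[OF e(1)[symmetric] e(3)[symmetric] c(1,3) f h] n(2,1)] f g h c
      by blast
    then show ?thesis using f g h by (simp add: C_iff_prec)
  qed
  moreover have "f \<in> H #> f" "g \<in> H #> g" "h \<in> H #> h"
    using f g h rcos_self subgroup_axioms by blast+
  ultimately show ?thesis
    using rcos_eq_iff f g h unfolding quotient_C_def by blast
qed

lemma carrier_FactGroup: "carrier (G Mod H) = (\<lambda>x. H #> x) ` carrier G"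
  by (auto simp: FactGroup_def RCOSETS_def)

lemma one_quotient: "\<one>\<^bsub>G Mod H\<^esub> = H"
  by (simp add: FactGroup_def)

lemma C_group_quotient: "C_group (G Mod H) (quotient_C C)"
proof -
  let ?D = "quotient_C C"
  \<comment> \<open>Proved before the swap axiom, which needs it to see that \<open>x\<close> and
    \<open>y\<close> lie in different cosets: in a common coset \<open>C2\<close> would deny its own
    premise.\<close>
  have C2: "\<not> ?D (H #> y) (H #> x) (H #> z)"
    if "?D (H #> x) (H #> y) (H #> z)" "x \<in> carrier G" "y \<in> carrier G" "z \<in> carrier G" for x y z
    using that prec_asym[of "y \<otimes> inv z" "x \<otimes> inv z"] by (auto simp: quotient_C_rcos C_iff_prec)
  have C1: "?D (H #> x) (H #> z) (H #> y)" if D: "?D (H #> x) (H #> y) (H #> z)"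
    and x: "x \<in> carrier G" "y \<in> carrier G" "z \<in> carrier G" for x y z
  proof (cases "H #> y = H #> z")
    case True
    then show ?thesis using D by simp
  next
    case False
    have "H #> x \<noteq> H #> y" using C2[of x y z] D x by auto
    then have "x \<otimes> inv y \<notin> H" using x rcos_eq_iff by blast
    moreover have "y \<otimes> inv z \<notin> H" using False x rcos_eq_iff by blast
    then have "C x y z" using D x quotient_C_rcos by blast
    then have "C x z y" using C_swap x by blast
    ultimately show ?thesis using x quotient_C_rcos by blast
  qed
  have C3: "?D (H #> w) (H #> y) (H #> z) \<or> ?D (H #> x) (H #> w) (H #> z)"
    if "?D (H #> x) (H #> y) (H #> z)" "x \<in> carrier G" "y \<in> carrier G" "z \<in> carrier G" "w \<in> carrier G"
    for x y z w
    using that prec_cotrans[of "y \<otimes> inv z" "x \<otimes> inv z" "w \<otimes> inv z"]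
    by (auto simp: quotient_C_rcos C_iff_prec)
  have C4: "?D X Y Y" if "X \<noteq> Y" for X Y
    using that by (simp add: quotient_C_def)
  have comp: "?D (H #> (v \<otimes> x \<otimes> u)) (H #> (v \<otimes> y \<otimes> u)) (H #> (v \<otimes> z \<otimes> u))"
    if D: "?D (H #> x) (H #> y) (H #> z)"
      and x: "x \<in> carrier G" "y \<in> carrier G" "z \<in> carrier G" "u \<in> carrier G" "v \<in> carrier G" for x y z u v
  proof -
    have "C (v \<otimes> x \<otimes> u) (v \<otimes> y \<otimes> u) (v \<otimes> z \<otimes> u)" if "C x y z"
      using that x by (simp add: C_mult_left C_mult_right)
    moreover have "v \<otimes> a \<otimes> u \<otimes> inv (v \<otimes> b \<otimes> u) \<in> H \<longleftrightarrow> a \<otimes> inv b \<in> H"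
      if "a \<in> carrier G" "b \<in> carrier G" for a b
    proof -
      have "v \<otimes> a \<otimes> u \<otimes> inv (v \<otimes> b \<otimes> u) = v \<otimes> (a \<otimes> inv b) \<otimes> inv v"
        using that x by (simp add: inv_mult_group m_assoc mult_inv_cancel)
      moreover have "inv v \<otimes> (v \<otimes> (a \<otimes> inv b) \<otimes> inv v) \<otimes> v = a \<otimes> inv b"
        using that x by (simp add: m_assoc mult_inv_cancel)
      ultimately show ?thesis
        using inv_op_closed2[of v "a \<otimes> inv b"] inv_op_closed1[of v "v \<otimes> (a \<otimes> inv b) \<otimes> inv v"] x
        by metis
    qed
    ultimately show ?thesis using D x by (auto simp: quotient_C_rcos)
  qed
  have "C_relation_on (carrier (G Mod H)) ?D"
    unfolding C_relation_on_def carrier_FactGroup ball_simps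
    by (intro conjI ballI impI) (rule C1 C2 C3 C4; assumption)+
  moreover have "C_compatible (G Mod H) ?D"
    unfolding C_compatible_def
  proof (intro ballI impI)
    fix X Y Z U V assume "X \<in> carrier (G Mod H)" "Y \<in> carrier (G Mod H)" "Z \<in> carrier (G Mod H)"
      "U \<in> carrier (G Mod H)" "V \<in> carrier (G Mod H)" and D: "?D X Y Z"
    then obtain x y z u v where
      x: "x \<in> carrier G" "y \<in> carrier G" "z \<in> carrier G" "u \<in> carrier G" "v \<in> carrier G"
      and X: "X = H #> x" "Y = H #> y" "Z = H #> z" "U = H #> u" "V = H #> v"
      unfolding carrier_FactGroup by blast
    show "?D (V \<otimes>\<^bsub>G Mod H\<^esub> X \<otimes>\<^bsub>G Mod H\<^esub> U) (V \<otimes>\<^bsub>G Mod H\<^esub> Y \<otimes>\<^bsub>G Mod H\<^esub> U) (V \<otimes>\<^bsub>G Mod H\<^esub> Z \<otimes>\<^bsub>G Mod H\<^esub> U)"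
      using comp[of x y z u v] D x X by (simp add: FactGroup_def rcos_sum)
  qed
  ultimately show ?thesis
    using factorgroup_is_group by (simp add: C_group_def)
qed

sublocale Q: c_group "G Mod H" "quotient_C C"
  by (simp add: c_group_def c_group_axioms_def C_group_quotient factorgroup_is_group)

lemma Q_prec:
  assumes "x \<in> carrier G" "y \<in> carrier G"
  shows "Q.prec (H #> x) (H #> y) \<longleftrightarrow> y \<notin> H \<and> (x \<in> H \<or> x \<prec> y)"
proof -
  have "H = H #> \<one>" using subset by simp
  then have "Q.prec (H #> x) (H #> y) \<longleftrightarrow> quotient_C C (H #> y) (H #> x) (H #> \<one>)"
    unfolding Q.prec_def one_quotient by metis
  then show ?thesis using assms quotient_C_rcos[of y x \<one>] by (simp add: prec_def)
qed

lemma Q_inv: "x \<in> carrier G \<Longrightarrow> inv\<^bsub>G Mod H\<^esub> (H #> x) = H #> inv x"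
  using inv_FactGroup[of "H #> x"] rcos_inv[of x] carrier_FactGroup by (metis imageI)

text \<open>For \<open>x \<in> H\<close> the coset is the identity, which is balanced even when
  \<open>x\<close> is not.\<close>

lemma Q_balanced:
  assumes "x \<in> carrier G" "x \<notin> H"
  shows "Q.balanced (H #> x) \<longleftrightarrow> balanced x"
proof -
  have "inv x \<notin> H" using assms m_inv_closed[of "inv x"] by auto
  then show ?thesis using assms by (simp add: Q.balanced_def balanced_def Q_inv Q_prec)
qed

lemma Q_lower:
  assumes "x \<in> carrier G" "x \<notin> H"
  shows "Q.lower (H #> x) = H #> lower x" "lower x \<notin> H"
proof -
  have "inv x \<notin> H" using assms m_inv_closed[of "inv x"] by auto
  then show "Q.lower (H #> x) = H #> lower x" "lower x \<notin> H"
    using assms by (simp_all add: Q.lower_def lower_def Q_inv Q_prec)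
qed

lemma valuational_quotient:
  assumes "\<And>x. x \<in> carrier G \<Longrightarrow> x \<notin> H \<Longrightarrow> balanced x"
  shows "valuational (G Mod H) (quotient_C C)"
proof (rule Q.valuational_if_balanced)
  fix X assume "X \<in> carrier (G Mod H)"
  then obtain x where x: "x \<in> carrier G" "X = H #> x" unfolding carrier_FactGroup by blast
  have "inv x \<in> H" if "x \<in> H" using that by (rule m_inv_closed)
  then show "Q.balanced X"
    using x assms[of x] Q_balanced[of x] by (cases "x \<in> H") (auto simp: Q.balanced_def Q_inv Q_prec)
qed

lemma order_type_quotient:
  assumes "\<And>x. x \<in> carrier G \<Longrightarrow> x \<notin> H \<Longrightarrow> \<not> balanced x"
    and "\<And>x y. x \<in> carrier G \<Longrightarrow> x \<notin> H \<Longrightarrow> y \<in> carrier G \<Longrightarrow> y \<notin> H \<Longrightarrow> lower x \<preceq> lower y"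
  shows "order_type (G Mod H) (quotient_C C)"
proof (rule Q.order_type_if_unbalanced)
  fix X assume "X \<in> carrier (G Mod H)" "X \<noteq> \<one>\<^bsub>G Mod H\<^esub>"
  then obtain x where x: "x \<in> carrier G" "X = H #> x" "x \<notin> H"
    using rcos_eq_self_iff unfolding carrier_FactGroup one_quotient by blast
  then show "\<not> Q.balanced X" using assms(1) Q_balanced by blast
  fix Y assume "Y \<in> carrier (G Mod H)" "Y \<noteq> \<one>\<^bsub>G Mod H\<^esub>"
  then obtain y where y: "y \<in> carrier G" "Y = H #> y" "y \<notin> H"
    using rcos_eq_self_iff unfolding carrier_FactGroup one_quotient by blast
  then show "\<not> Q.prec (Q.lower Y) (Q.lower X)"
    using x assms(2)[of x y] Q_lower[of x] Q_lower[of y] Q_prec[of "lower y" "lower x"] lower_closed by metis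
qed

end

section \<open>The quotients of the valuation\<close>

context c_group
begin

text \<open>For \<open>a\<close> of value \<open>\<gamma>\<close> this is
  \<open>G\<^sup>\<gamma>\<close>, and \<open>strict_upper a\<close> is
  \<open>G\<^sub>\<gamma>\<close>. Representatives stand for values, since the order of values is
  the reverse of \<open>coarse\<close>.\<close>

definition upper :: "'a \<Rightarrow> 'a set" where
  "upper a = {g \<in> carrier G. \<not> coarse a g}"

definition strict_upper :: "'a \<Rightarrow> 'a set" where
  "strict_upper a = {g \<in> carrier G. coarse g a}"

lemma coarse_irrefl: "x \<in> carrier G \<Longrightarrow> \<not> coarse x x"
  using coarse_asym by blast

lemma subgroup_upper:
  assumes a: "a \<in> carrier G"
  shows "subgroup (upper a) G"
proof (rule subgroupI)
  have one: "\<not> coarse a \<one>"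
    using a coarse_one[of a] coarse_asym[of \<one> a] coarse_irrefl[of a] by (cases "a = \<one>") auto
  then show "upper a \<noteq> {}" by (auto simp: upper_def)
  show inv: "inv x \<in> upper a" if "x \<in> upper a" for x
    using that one a coarse_mult[of a \<one> x] by (auto simp: upper_def)
  show "x \<otimes> y \<in> upper a" if "x \<in> upper a" "y \<in> upper a" for x y
    using that inv[of y] a coarse_mult[of a x "inv y"] by (auto simp: upper_def)
qed (auto simp: upper_def)

lemma subgroup_strict_upper:
  assumes a: "a \<in> carrier G" "a \<noteq> \<one>"
  shows "subgroup (strict_upper a) G"
proof -
  have div: "x \<otimes> inv y \<in> strict_upper a" if "x \<in> strict_upper a" "y \<in> strict_upper a" for x y
  proof (rule ccontr)
    have xy: "x \<in> carrier G" "y \<in> carrier G" "coarse x a" "coarse y a"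
      using that by (auto simp: strict_upper_def)
    assume "x \<otimes> inv y \<notin> strict_upper a"
    then have "coarse x (x \<otimes> inv y)" "coarse y (x \<otimes> inv y)"
      using xy a coarse_cotrans[of x a "x \<otimes> inv y"] coarse_cotrans[of y a "x \<otimes> inv y"]
      by (auto simp: strict_upper_def)
    \<comment> \<open>By \<open>coarse_mult\<close> each of \<open>x\<close> and \<open>y\<close>
      would have a value strictly above that of the other.\<close>
    then show False
      using coarse_mult[of x x y] coarse_mult[of y x y] coarse_asym[of x y] coarse_irrefl xy by blast
  qed
  have one: "\<one> \<in> strict_upper a" using a coarse_one by (simp add: strict_upper_def)
  show ?thesis
  proof (rule subgroupI)
    show inv: "inv x \<in> strict_upper a" if "x \<in> strict_upper a" for x
      using div[OF one that] that by (auto simp: strict_upper_def)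
    show "x \<otimes> y \<in> strict_upper a" if "x \<in> strict_upper a" "y \<in> strict_upper a" for x y
      using div[OF that(1) inv[OF that(2)]] that by (auto simp: strict_upper_def)
  qed (use one in \<open>auto simp: strict_upper_def\<close>)
qed

lemma strict_upper_subset: "a \<in> carrier G \<Longrightarrow> strict_upper a \<subseteq> upper a"
  using coarse_asym by (auto simp: strict_upper_def upper_def)

text \<open>Conjugation preserves the order of values, not values themselves. So
  \<open>x \<otimes> h \<otimes> inv x\<close> has larger value than
  \<open>x \<otimes> a \<otimes> inv x\<close>, which lies in \<open>upper a\<close> because its
  factors do.\<close>

lemma strict_upper_conj:
  assumes "a \<in> carrier G" "x \<in> upper a" "h \<in> strict_upper a"
  shows "x \<otimes> h \<otimes> inv x \<in> strict_upper a"
proof -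
  note U = subgroup_upper[OF assms(1)]
  have c: "x \<in> carrier G" "h \<in> carrier G" "coarse h a"
    using assms by (auto simp: upper_def strict_upper_def)
  have "a \<in> upper a" using assms coarse_irrefl by (simp add: upper_def)
  then have "x \<otimes> a \<otimes> inv x \<in> upper a"
    by (intro subgroup.m_closed[OF U] subgroup.m_inv_closed[OF U] assms(2))
  then have "\<not> coarse a (x \<otimes> a \<otimes> inv x)" by (simp add: upper_def)
  moreover have "coarse (x \<otimes> h \<otimes> inv x) (x \<otimes> a \<otimes> inv x)"
    using c assms(1) by (intro coarse_conj)
  ultimately show ?thesis
    using c assms coarse_cotrans[of "x \<otimes> h \<otimes> inv x" "x \<otimes> a \<otimes> inv x" a] by (auto simp: strict_upper_def)
qed

lemma c_group_subgroup:
  assumes "subgroup K G"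
  shows "c_group (G\<lparr>carrier := K\<rparr>) C"
proof -
  have K: "K \<subseteq> carrier G" using assms by (rule subgroup.subset)
  have "C_relation_on K C"
    using C_group K unfolding C_group_def C_relation_on_def by (meson subsetD)
  moreover have "C_compatible (G\<lparr>carrier := K\<rparr>) C"
    using C_group K unfolding C_group_def C_compatible_def by (simp add: subset_iff)
  ultimately show ?thesis
    using subgroup_imp_group[OF assms]
    by (simp add: c_group_def c_group_axioms_def C_group_def)
qed

context
  fixes a
  assumes a: "a \<in> carrier G" "a \<noteq> \<one>"
begin

lemma inv_upper: "x \<in> upper a \<Longrightarrow> inv\<^bsub>G\<lparr>carrier := upper a\<rparr>\<^esub> x = inv x"
  using m_inv_consistent subgroup_upper a by blast

lemma prec_upper: "c_group.prec (G\<lparr>carrier := upper a\<rparr>) C x y \<longleftrightarrow> x \<prec> y"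
  using c_group.prec_def[OF c_group_subgroup[OF subgroup_upper[OF a(1)]]] by (simp add: prec_def)

lemma balanced_upper: "x \<in> upper a \<Longrightarrow> c_group.balanced (G\<lparr>carrier := upper a\<rparr>) C x \<longleftrightarrow> balanced x"
  using c_group.balanced_def[OF c_group_subgroup[OF subgroup_upper[OF a(1)]]]
  by (simp add: balanced_def prec_upper inv_upper)

lemma lower_upper: "x \<in> upper a \<Longrightarrow> c_group.lower (G\<lparr>carrier := upper a\<rparr>) C x = lower x"
  using c_group.lower_def[OF c_group_subgroup[OF subgroup_upper[OF a(1)]]]
  by (simp add: lower_def prec_upper inv_upper)

lemma c_quotient_upper: "c_quotient (G\<lparr>carrier := upper a\<rparr>) C (strict_upper a)"
proof -
  interpret U: c_group "G\<lparr>carrier := upper a\<rparr>" C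
    using c_group_subgroup subgroup_upper a by blast
  have "normal (strict_upper a) (G\<lparr>carrier := upper a\<rparr>)"
  proof (rule U.normal_invI)
    show "subgroup (strict_upper a) (G\<lparr>carrier := upper a\<rparr>)"
      using subgroup_incl subgroup_strict_upper subgroup_upper strict_upper_subset a by blast
  qed (use strict_upper_conj a in \<open>simp add: inv_upper\<close>)
  moreover have "k \<otimes> x \<preceq> x \<and> x \<preceq> k \<otimes> x"
    if "x \<in> upper a" "x \<notin> strict_upper a" "k \<in> strict_upper a" for x k
  proof -
    \<comment> \<open>Outside \<open>strict_upper a\<close>, an element of \<open>upper a\<close>
      has exactly the value of \<open>a\<close>, which is below that of \<open>k\<close>.\<close>
    have "coarse k x"
      using that a coarse_cotrans[of k a x] by (auto simp: upper_def strict_upper_def)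
    then show ?thesis
      using that mult_fine_equiv[of k x] fine_if_coarse by (auto simp: upper_def strict_upper_def)
  qed
  ultimately show ?thesis
    by (simp add: c_quotient_def c_quotient_axioms_def U.c_group_axioms prec_upper)
qed

interpretation Q: c_quotient "G\<lparr>carrier := upper a\<rparr>" C "strict_upper a"
  by (rule c_quotient_upper)

lemma C_group_upper_quotient:
  "C_group (G\<lparr>carrier := upper a\<rparr> Mod strict_upper a) (quotient_C C)"
  by (rule Q.C_group_quotient)

text \<open>The theorem is phrased with left cosets, the quotient group with right cosets; normality
  identifies them.\<close>

lemma quotient_C_upper:
  assumes "f \<in> upper a" "g \<in> upper a" "h \<in> upper a"
  shows "quotient_C C (f <# strict_upper a) (g <# strict_upper a) (h <# strict_upper a) \<longleftrightarrow>
    f \<otimes> inv h \<notin> strict_upper a \<and> (g \<otimes> inv h \<in> strict_upper a \<or> C f g h)"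
proof -
  have "x <# strict_upper a = strict_upper a #>\<^bsub>G\<lparr>carrier := upper a\<rparr>\<^esub> x" if "x \<in> upper a" for x
    using that Q.coset_eq by (auto simp: l_coset_def)
  then show ?thesis
    using Q.quotient_C_rcos[of f g h] assms by (simp add: inv_upper)
qed

lemma balanced_iff:
  assumes "x \<in> upper a" "x \<notin> strict_upper a"
  shows "balanced x \<longleftrightarrow> balanced a"
  using coarse_equiv_balanced[of x a] assms a by (auto simp: upper_def strict_upper_def)

text \<open>The \<open>fine\<close> values that were merged into the value of \<open>a\<close>
  reappear as values of the valuation on the quotient.\<close>

lemma valuational_upper_quotient:
  assumes "balanced a"
  shows "valuational (G\<lparr>carrier := upper a\<rparr> Mod strict_upper a) (quotient_C C)"
  by (rule Q.valuational_quotient) (use balanced_iff balanced_upper assms in auto)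

text \<open>An unbalanced value is not merged with any other, so its elements are
  \<open>fine\<close>-equivalent and have \<open>\<prec>\<close>-equivalent
  \<open>lower\<close>.\<close>

lemma order_type_upper_quotient:
  assumes "\<not> balanced a"
  shows "order_type (G\<lparr>carrier := upper a\<rparr> Mod strict_upper a) (quotient_C C)"
proof (rule Q.order_type_quotient)
  fix x assume x: "x \<in> carrier (G\<lparr>carrier := upper a\<rparr>)" "x \<notin> strict_upper a"
  then show "\<not> c_group.balanced (G\<lparr>carrier := upper a\<rparr>) C x"
    using balanced_iff balanced_upper assms by auto
  fix y assume y: "y \<in> carrier (G\<lparr>carrier := upper a\<rparr>)" "y \<notin> strict_upper a"
  have c: "x \<in> carrier G" "y \<in> carrier G" "\<not> balanced y"
    using x y balanced_iff assms by (auto simp: upper_def)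
  have "\<not> coarse y x"
    using x y c a coarse_cotrans[of y x a] by (auto simp: upper_def strict_upper_def)
  then have "\<not> fine y x" using c coarse_unbalanced_iff by blast
  then have "lower x \<preceq> lower y" by (auto simp: fine_def)
  then show "\<not> c_group.prec (G\<lparr>carrier := upper a\<rparr>) C
      (c_group.lower (G\<lparr>carrier := upper a\<rparr>) C y) (c_group.lower (G\<lparr>carrier := upper a\<rparr>) C x)"
    using x y by (simp add: prec_upper lower_upper)
qed

lemma balanced_if_valuational_upper_quotient:
  assumes "valuational (G\<lparr>carrier := upper a\<rparr> Mod strict_upper a) (quotient_C C)"
  shows "balanced a"
proof -
  have "a \<in> upper a" "a \<notin> strict_upper a"
    using a coarse_irrefl by (auto simp: upper_def strict_upper_def)
  then show ?thesis
    using Q.Q.balanced_if_valuational[OF assms, of "strict_upper a #>\<^bsub>G\<lparr>carrier := upper a\<rparr>\<^esub> a"]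
      Q.Q_balanced[of a] Q.carrier_FactGroup balanced_upper[of a]
    by auto
qed

end

text \<open>The \<open>n\<close> in the definition of \<open>coarse\<close> lies weakly between
  \<open>x\<close> and \<open>y\<close>. Being unbalanced, it is \<open>fine\<close>-equivalent to
  neither, so it lies strictly between.\<close>

lemma coarse_between:
  assumes "coarse x y" "balanced x" "balanced y" "x \<noteq> \<one>" "x \<in> carrier G" "y \<in> carrier G"
  obtains n where "n \<in> carrier G" "\<not> balanced n" "coarse x n" "coarse n y"
proof -
  obtain n where n: "n \<in> carrier G" "\<not> balanced n" "\<not> fine n x" "\<not> fine y n"
    using assms by (auto simp: coarse_def)
  then have "fine x n" "fine n y"
    using assms fine_equiv(1) by blast+
  then show ?thesis using that n assms coarse_unbalanced_iff by blast
qed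

end

section \<open>The valuation given by \<open>coarse\<close> and the alternation of its
  quotients\<close>

theorem theorem3p42:
  fixes G :: "('a, 'b) monoid_scheme" (structure)
    and C :: "'a \<Rightarrow> 'a \<Rightarrow> 'a \<Rightarrow> bool"
  assumes "C_group G C"
  shows "\<exists>(\<Gamma> :: 'a set set) (r :: 'a set rel) (v :: 'a \<Rightarrow> 'a set option)
            (D :: 'a set \<Rightarrow> 'a set \<Rightarrow> 'a set \<Rightarrow> 'a set \<Rightarrow> bool).
    valuation G \<Gamma> r v \<and> v ` carrier G = insert None (Some ` \<Gamma>) \<and>
    (\<forall>\<gamma>\<in>\<Gamma>.
       C_group (val_quotient G r v \<gamma>) (D \<gamma>) \<and>
       (\<forall>f\<in>val_ge_set G r v \<gamma>. \<forall>g\<in>val_ge_set G r v \<gamma>. \<forall>h\<in>val_ge_set G r v \<gamma>.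
          D \<gamma> (f <# val_gt_set G r v \<gamma>) (g <# val_gt_set G r v \<gamma>) (h <# val_gt_set G r v \<gamma>) \<longleftrightarrow>
          f \<otimes> inv h \<notin> val_gt_set G r v \<gamma> \<and> (g \<otimes> inv h \<in> val_gt_set G r v \<gamma> \<or> C f g h))) \<and>
    (\<forall>\<gamma>\<in>\<Gamma>. elementary_type (val_quotient G r v \<gamma>) (D \<gamma>)) \<and>
    (\<forall>\<gamma>\<in>\<Gamma>. \<forall>\<delta>\<in>\<Gamma>.
       (\<gamma>, \<delta>) \<in> r \<and> \<gamma> \<noteq> \<delta> \<and>
       valuational (val_quotient G r v \<gamma>) (D \<gamma>) \<and> valuational (val_quotient G r v \<delta>) (D \<delta>) \<longrightarrow>
       (\<exists>\<alpha>\<in>\<Gamma>. (\<gamma>, \<alpha>) \<in> r \<and> \<gamma> \<noteq> \<alpha> \<and> (\<alpha>, \<delta>) \<in> r \<and> \<alpha> \<noteq> \<delta> \<and>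
          order_type (val_quotient G r v \<alpha>) (D \<alpha>)))"
proof -
  interpret c_group G C
    using assms by (simp add: c_group_def c_group_axioms_def C_group_def)
  have "\<exists>(\<Gamma> :: 'a set set) r v. valuation G \<Gamma> r v \<and> v ` carrier G = insert None (Some ` \<Gamma>) \<and>
    (\<forall>x\<in>carrier G. \<forall>y\<in>carrier G. val_le r (v x) (v y) \<longleftrightarrow> \<not> coarse x y) \<and>
    (\<forall>x\<in>carrier G. \<forall>y\<in>carrier G. val_less r (v x) (v y) \<longleftrightarrow> coarse y x)"
    by (rule valuation_from_strict_weak_order)
      (rule coarse_asym coarse_cotrans coarse_one coarse_mult coarse_conj; assumption)+
  then obtain \<Gamma> :: "'a set set" and r v where val: "valuation G \<Gamma> r v"
    and img: "v ` carrier G = insert None (Some ` \<Gamma>)"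
    and le: "\<forall>x\<in>carrier G. \<forall>y\<in>carrier G. val_le r (v x) (v y) \<longleftrightarrow> \<not> coarse x y"
    and less: "\<forall>x\<in>carrier G. \<forall>y\<in>carrier G. val_less r (v x) (v y) \<longleftrightarrow> coarse y x"
    by blast
  have none: "\<forall>g\<in>carrier G. v g = None \<longleftrightarrow> g = \<one>"
    using val by (simp add: valuation_def)
  have repr: "\<exists>a. a \<in> carrier G \<and> a \<noteq> \<one> \<and> v a = Some \<gamma>" if "\<gamma> \<in> \<Gamma>" for \<gamma>
  proof -
    have "Some \<gamma> \<in> v ` carrier G" using that img by simp
    then obtain a where "a \<in> carrier G" "v a = Some \<gamma>" by (metis imageE)
    moreover from this have "a \<noteq> \<one>" using none by fastforce
    ultimately show ?thesis by blast
  qed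
  have sets: "val_ge_set G r v \<gamma> = upper a" "val_gt_set G r v \<gamma> = strict_upper a"
    "val_quotient G r v \<gamma> = G\<lparr>carrier := upper a\<rparr> Mod strict_upper a"
    if a: "a \<in> carrier G" "v a = Some \<gamma>" for a \<gamma>
  proof -
    show ge: "val_ge_set G r v \<gamma> = upper a"
      unfolding val_ge_set_def upper_def a(2)[symmetric] using le a(1) by blast
    show gt: "val_gt_set G r v \<gamma> = strict_upper a"
      unfolding val_gt_set_def strict_upper_def a(2)[symmetric] using less a(1) by blast
    show "val_quotient G r v \<gamma> = G\<lparr>carrier := upper a\<rparr> Mod strict_upper a"
      unfolding val_quotient_def ge gt by (rule refl)
  qed
  have between: "\<exists>\<alpha>\<in>\<Gamma>. (\<gamma>, \<alpha>) \<in> r \<and> \<gamma> \<noteq> \<alpha> \<and> (\<alpha>, \<delta>) \<in> r \<and> \<alpha> \<noteq> \<delta> \<and>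
      order_type (val_quotient G r v \<alpha>) (quotient_C C)"
    if \<gamma>\<delta>: "\<gamma> \<in> \<Gamma>" "\<delta> \<in> \<Gamma>" "(\<gamma>, \<delta>) \<in> r" "\<gamma> \<noteq> \<delta>"
      and vt: "valuational (val_quotient G r v \<gamma>) (quotient_C C)"
        "valuational (val_quotient G r v \<delta>) (quotient_C C)" for \<gamma> \<delta>
  proof -
    obtain a b where ab: "a \<in> carrier G" "a \<noteq> \<one>" "v a = Some \<gamma>" "b \<in> carrier G" "b \<noteq> \<one>" "v b = Some \<delta>"
      using repr \<gamma>\<delta> by blast
    have lt: "coarse y x \<longleftrightarrow> (\<mu>, \<nu>) \<in> r \<and> \<mu> \<noteq> \<nu>"
      if "x \<in> carrier G" "y \<in> carrier G" "v x = Some \<mu>" "v y = Some \<nu>" for x y \<mu> \<nu>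
    proof -
      have "coarse y x \<longleftrightarrow> val_less r (v x) (v y)" using less that by blast
      then show ?thesis using that by (simp add: val_less_def val_le_def)
    qed
    \<comment> \<open>The larger value \<open>\<delta>\<close> belongs to the element that comes
      first in \<open>coarse\<close>.\<close>
    have "coarse b a" using lt[of a b \<gamma> \<delta>] ab \<gamma>\<delta> by blast
    moreover have "balanced a" "balanced b"
      using vt sets(3) ab balanced_if_valuational_upper_quotient by metis+
    ultimately obtain n where n: "n \<in> carrier G" "\<not> balanced n" "coarse b n" "coarse n a"
      using coarse_between ab by blast
    have "n \<noteq> \<one>" using n ab coarse_asym coarse_one by metis
    then obtain \<alpha> where \<alpha>: "v n = Some \<alpha>" using none n(1) by blast
    have "v n \<in> insert None (Some ` \<Gamma>)" using img n(1) by blast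
    then have "\<alpha> \<in> \<Gamma>" using \<alpha> by auto
    moreover have "order_type (val_quotient G r v \<alpha>) (quotient_C C)"
      using order_type_upper_quotient n \<open>n \<noteq> \<one>\<close> sets(3)[OF n(1) \<alpha>] by simp
    moreover have "(\<gamma>, \<alpha>) \<in> r \<and> \<gamma> \<noteq> \<alpha>" "(\<alpha>, \<delta>) \<in> r \<and> \<alpha> \<noteq> \<delta>"
      using lt[of a n \<gamma> \<alpha>] lt[of n b \<alpha> \<delta>] ab n \<alpha> by blast+
    ultimately show ?thesis by blast
  qed
  have cgroup: "C_group (val_quotient G r v \<gamma>) (quotient_C C)" if "\<gamma> \<in> \<Gamma>" for \<gamma>
    using repr[OF that] sets(3) C_group_upper_quotient by metis
  have formula: "quotient_C C (f <# val_gt_set G r v \<gamma>) (g <# val_gt_set G r v \<gamma>) (h <# val_gt_set G r v \<gamma>) \<longleftrightarrow>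
      f \<otimes> inv h \<notin> val_gt_set G r v \<gamma> \<and> (g \<otimes> inv h \<in> val_gt_set G r v \<gamma> \<or> C f g h)"
    if \<gamma>: "\<gamma> \<in> \<Gamma>" and fgh: "f \<in> val_ge_set G r v \<gamma>" "g \<in> val_ge_set G r v \<gamma>" "h \<in> val_ge_set G r v \<gamma>" for \<gamma> f g h
  proof -
    obtain a where a: "a \<in> carrier G" "a \<noteq> \<one>" "v a = Some \<gamma>" using repr[OF \<gamma>] by blast
    show ?thesis
      using fgh unfolding sets(1,2)[OF a(1,3)] by (rule quotient_C_upper[OF a(1,2)])
  qed
  have elem: "elementary_type (val_quotient G r v \<gamma>) (quotient_C C)" if \<gamma>: "\<gamma> \<in> \<Gamma>" for \<gamma>
  proof -
    obtain a where a: "a \<in> carrier G" "a \<noteq> \<one>" "v a = Some \<gamma>" using repr[OF \<gamma>] by blast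
    show ?thesis
      using valuational_upper_quotient[OF a(1,2)] order_type_upper_quotient[OF a(1,2)] sets(3)[OF a(1,3)]
      by (auto simp: elementary_type_def)
  qed
  show ?thesis
    \<comment> \<open>One relation on sets serves for every \<open>\<gamma>\<close>, since
      \<open>quotient_C C\<close> refers only to the cosets it is applied to.\<close>
    by (rule exI[of _ \<Gamma>], rule exI[of _ r], rule exI[of _ v], rule exI[of _ "\<lambda>_. quotient_C C"])
      (intro conjI ballI impI; (elim conjE)?; rule val img cgroup formula elem between; assumption)
qed

end
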